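(* Let $\eta \geq \frac{2\log(16 n^2 d^2) + 16|\mathcal{E}| d^2}{\min(\Delta, \frac{1}{128})}$ and let $\epsilon^{-1} > (25 d \deg(\mathcal{G}) |\mathcal{E}|)^2 \max\left(\eta \|C\|_\infty, 68\right)$. If $\mathbb{L}_2$ is tight and $|\mathcal{V}^*_2| = 1$, then the EMP algorithm (run with inputs $C,\eta,\epsilon$) returns a MAP assignment after $\left\lceil \frac{4\mathcal{S}_0(\deg(\mathcal{G})+1)}{\epsilon^2} \right\rceil$ iterations for EMP-cyclic and after $\left\lceil \frac{4\mathcal{S}_0}{\epsilon^2} \right\rceil$ iterations for EMP-greedy.
   Context: Pairwise graphical model on $\mathcal{G}=(\mathcal{V},\mathcal{E})$ with $\mathcal{V}=\{1,\dots,n\}$, every vertex having at least one edge, states $\chi=\{0,\dots,d-1\}$, potentials $\theta_i(x_i)$, $\theta_{ij}(x_i,x_j)$; MAP inference is $\max_{x\in\chi^n}\sum_i\theta_i(x_i)+\sum_{ij}\theta_{ij}(x_i,x_j)$. A marginal vector $\Gamma$ consists of vectors $\Gamma_i\in\mathbb{R}_+^d$ and matrices $\Gamma_{ij}\in\mathbb{R}_+^{d\times d}$. The local polytope is $\mathbb{L}_2=\{\Gamma\ge 0: \Gamma_i\in\Sigma_d\ \forall i,\ \Gamma_{ij}\mathbbm{1}=\Gamma_i,\ \Gamma_{ij}^\top\mathbbm{1}=\Gamma_j\ \forall ij\}$, where $\Sigma_d$ is the probability simplex. Let $C=-\theta$. The LP relaxation is $\min\langle C,\Gamma\rangle$ over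 $\mathbb{L}_2$; $\mathbb{L}_2$ is called tight if this LP has an integral optimal solution. $\mathcal{V}_2$ is the set of vertices of $\mathbb{L}_2$, $\mathcal{V}^*_2$ the set of optimal vertices w.r.t. $C$, and $\Delta=\min_{V_1\in\mathcal{V}_2\setminus\mathcal{V}_2^*,V_2\in\mathcal{V}_2^*}\langle C,V_1\rangle-\langle C,V_2\rangle$. The entropy-regularized problem is $\min_{\Gamma\in\mathbb{L}_2}\langle C,\Gamma\rangle-\frac1\eta H(\Gamma)$ with $H(\Gamma)=\langle\Gamma,-\log\Gamma+\mathbbm{1}\rangle$, equivalently the Bregman (KL) projection of $\exp(-\eta C)$ onto $\mathbb{L}_2$. EMP (edge-based message passing) initializes $\Gamma$ as $\exp(-\eta C)$ with each vertex and edge component normalized to sum to one, and for an edge $ij$ applies closed-form Bregman projections: left consistency $\Gamma_{ij}(x_i,x_j)\leftarrow\Gamma_{ij}(x_i,x_j)\sqrt{\Gamma_i(x_i)/\sum_x\Gamma_{ij}(x_i,x)}$, $\Gamma_i(x_i)\leftarrow\Gamma_i(x_i)\sqrt{\sum_x\Gamma_{ij}(x_i,x)/\Gamma_i(x_i)}$; left normalization (normalize $\Gamma_i$ and $\Gamma_{ij}$ to sum to one); and the analogous right consistency/normalization with columns and vertex $j$. EMP-cyclic, in each iteration, applies left consistency, left normalization, right consistency, right normalization to every edge in order; EMP-greedy, in each iteration, picks the edge and side with the largest violation $\max\{\|\Gamma_{ij}\mathbbm{1}-\Gamma_i\|_1,\|\Gamma_{ij}^\top\mathbbm{1}-\Gamma_j\|_1\}$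 and applies that side's consistency then normalization. Both stop once all violations $\|\Gamma_{ij}\mathbbm{1}-\Gamma_i\|_1$, $\|\Gamma_{ij}^\top\mathbbm{1}-\Gamma_j\|_1$ are below $\epsilon$, and return the rounding $x_i=\arg\max_x\Gamma_i(x)$. $\deg(\mathcal{G})$ is the maximum degree. $\mathcal{S}_0=\min(\|\eta C/d+\exp(-\eta C)\|_1, S)$ with $S=\sum_{ij\in\mathcal{E}}[\log\sum_{x_i,x_j}e^{-\eta C_{ij}(x_i,x_j)}+\sum_{x_i,x_j}\frac{\eta}{d^2}C_{ij}(x_i,x_j)]+\sum_{i\in\mathcal{V}}[\log\sum_x e^{-\eta C_i(x)}+\sum_x\frac{\eta}{d}C_i(x)]$. *)

theory Defs
  imports "HOL-Analysis.Analysis"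
begin

text \<open>
  Conventions.  Vertices are 0..<n, states are 0..<d.  The graph is given by a
  list es of directed pairs (i,j) (the order of the list is the order in which
  EMP-cyclic sweeps the edges); the edge set is set es.  An edge (i,j) carries a
  d x d matrix indexed (x_i, x_j).  A marginal vector (and likewise the cost
  vector C = -theta) is a record with vertex part and edge part.
\<close>

record marg =
  vx :: "nat \<Rightarrow> nat \<Rightarrow> real"
  ed :: "nat \<times> nat \<Rightarrow> nat \<Rightarrow> nat \<Rightarrow> real"

definition graph_ok :: "nat \<Rightarrow> (nat \<times> nat) list \<Rightarrow> bool" where
  "graph_ok n es \<longleftrightarrow> distinct es \<and>
     (\<forall>(i,j)\<in>set es. i < n \<and> j < n \<and> i \<noteq> j \<and> (j,i) \<notin> set es) \<and>
     (\<forall>i<n. \<exists>(a,b)\<in>set es. a = i \<or> b = i)"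

definition deg :: "nat \<Rightarrow> (nat \<times> nat) set \<Rightarrow> nat" where
  "deg n E = Max ((\<lambda>i. card {e\<in>E. fst e = i \<or> snd e = i}) ` {..<n})"

definition inner_m :: "nat \<Rightarrow> nat \<Rightarrow> (nat \<times> nat) set \<Rightarrow> marg \<Rightarrow> marg \<Rightarrow> real" where
  "inner_m n d E C G =
     (\<Sum>i<n. \<Sum>x<d. vx C i x * vx G i x) +
     (\<Sum>e\<in>E. \<Sum>x<d. \<Sum>y<d. ed C e x y * ed G e x y)"

text \<open>Local polytope; entries outside the index range are required to be 0, so that
  marginal vectors are exactly the points of the finite-dimensional space.\<close>
definition L2 :: "nat \<Rightarrow> nat \<Rightarrow> (nat \<times> nat) set \<Rightarrow> marg set" where
  "L2 n d E = {G.
     (\<forall>i x. (i < n \<and> x < d \<longrightarrow> vx G i x \<ge> 0) \<and> (\<not>(i < n \<and> x < d) \<longrightarrow> vx G i x = 0)) \<and>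
     (\<forall>e x y. (e \<in> E \<and> x < d \<and> y < d \<longrightarrow> ed G e x y \<ge> 0) \<and>
              (\<not>(e \<in> E \<and> x < d \<and> y < d) \<longrightarrow> ed G e x y = 0)) \<and>
     (\<forall>i<n. (\<Sum>x<d. vx G i x) = 1) \<and>
     (\<forall>(i,j)\<in>E. (\<forall>x<d. (\<Sum>y<d. ed G (i,j) x y) = vx G i x) \<and>
                 (\<forall>y<d. (\<Sum>x<d. ed G (i,j) x y) = vx G j y))}"

definition comb_m :: "real \<Rightarrow> marg \<Rightarrow> marg \<Rightarrow> marg" where
  "comb_m t A B = \<lparr> vx = (\<lambda>i x. t * vx A i x + (1 - t) * vx B i x),
                    ed = (\<lambda>e x y. t * ed A e x y + (1 - t) * ed B e x y) \<rparr>"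

definition vertices_L2 :: "nat \<Rightarrow> nat \<Rightarrow> (nat \<times> nat) set \<Rightarrow> marg set" where
  "vertices_L2 n d E = {V \<in> L2 n d E.
     \<forall>A\<in>L2 n d E. \<forall>B\<in>L2 n d E. \<forall>t. 0 < t \<and> t < 1 \<and> V = comb_m t A B \<longrightarrow> A = B}"

definition lp_optimal :: "nat \<Rightarrow> nat \<Rightarrow> (nat \<times> nat) set \<Rightarrow> marg \<Rightarrow> marg \<Rightarrow> bool" where
  "lp_optimal n d E C G \<longleftrightarrow> G \<in> L2 n d E \<and> (\<forall>H\<in>L2 n d E. inner_m n d E C G \<le> inner_m n d E C H)"

definition opt_vertices :: "nat \<Rightarrow> nat \<Rightarrow> (nat \<times> nat) set \<Rightarrow> marg \<Rightarrow> marg set" where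
  "opt_vertices n d E C = {V \<in> vertices_L2 n d E. lp_optimal n d E C V}"

definition integral_m :: "marg \<Rightarrow> bool" where
  "integral_m G \<longleftrightarrow> (\<forall>i x. vx G i x \<in> \<int>) \<and> (\<forall>e x y. ed G e x y \<in> \<int>)"

definition L2_tight :: "nat \<Rightarrow> nat \<Rightarrow> (nat \<times> nat) set \<Rightarrow> marg \<Rightarrow> bool" where
  "L2_tight n d E C \<longleftrightarrow> (\<exists>G. lp_optimal n d E C G \<and> integral_m G)"

text \<open>Delta (the infimum over the empty set is +\<infinity>, i.e. when every vertex is optimal).\<close>
definition Delta :: "nat \<Rightarrow> nat \<Rightarrow> (nat \<times> nat) set \<Rightarrow> marg \<Rightarrow> ereal" where
  "Delta n d E C = Inf {ereal (inner_m n d E C V1 - inner_m n d E C V2) | V1 V2.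
       V1 \<in> vertices_L2 n d E - opt_vertices n d E C \<and> V2 \<in> opt_vertices n d E C}"

definition norm_inf_m :: "nat \<Rightarrow> nat \<Rightarrow> (nat \<times> nat) set \<Rightarrow> marg \<Rightarrow> real" where
  "norm_inf_m n d E C = Max ({\<bar>vx C i x\<bar> | i x. i < n \<and> x < d} \<union>
                              {\<bar>ed C e x y\<bar> | e x y. e \<in> E \<and> x < d \<and> y < d})"

definition norm1_m :: "nat \<Rightarrow> nat \<Rightarrow> (nat \<times> nat) set \<Rightarrow> marg \<Rightarrow> real" where
  "norm1_m n d E C = (\<Sum>i<n. \<Sum>x<d. \<bar>vx C i x\<bar>) + (\<Sum>e\<in>E. \<Sum>x<d. \<Sum>y<d. \<bar>ed C e x y\<bar>)"

definition S0 :: "nat \<Rightarrow> nat \<Rightarrow> (nat \<times> nat) set \<Rightarrow> marg \<Rightarrow> real \<Rightarrow> real" where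
  "S0 n d E C \<eta> = min
     (norm1_m n d E \<lparr> vx = (\<lambda>i x. \<eta> * vx C i x / d + exp (- \<eta> * vx C i x)),
                       ed = (\<lambda>e x y. \<eta> * ed C e x y / d + exp (- \<eta> * ed C e x y)) \<rparr>)
     ((\<Sum>e\<in>E. ln (\<Sum>x<d. \<Sum>y<d. exp (- \<eta> * ed C e x y))
              + (\<Sum>x<d. \<Sum>y<d. \<eta> / (real d)^2 * ed C e x y))
      + (\<Sum>i<n. ln (\<Sum>x<d. exp (- \<eta> * vx C i x)) + (\<Sum>x<d. \<eta> / real d * vx C i x)))"

definition energy :: "nat \<Rightarrow> (nat \<times> nat) set \<Rightarrow> marg \<Rightarrow> (nat \<Rightarrow> nat) \<Rightarrow> real" where
  "energy n E C x = (\<Sum>i<n. vx C i (x i)) + (\<Sum>(i,j)\<in>E. ed C (i,j) (x i) (x j))"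

text \<open>A MAP assignment maximizes \<Sum> theta = - \<Sum> C, i.e. minimizes the energy.\<close>
definition is_MAP :: "nat \<Rightarrow> nat \<Rightarrow> (nat \<times> nat) set \<Rightarrow> marg \<Rightarrow> (nat \<Rightarrow> nat) \<Rightarrow> bool" where
  "is_MAP n d E C x \<longleftrightarrow> (\<forall>i<n. x i < d) \<and>
     (\<forall>y. (\<forall>i<n. y i < d) \<longrightarrow> energy n E C x \<le> energy n E C y)"

definition rounding_of :: "nat \<Rightarrow> nat \<Rightarrow> marg \<Rightarrow> (nat \<Rightarrow> nat) \<Rightarrow> bool" where
  "rounding_of n d G x \<longleftrightarrow> (\<forall>i<n. x i < d \<and> (\<forall>y<d. vx G i y \<le> vx G i (x i)))"

definition emp_init :: "nat \<Rightarrow> nat \<Rightarrow> (nat \<times> nat) set \<Rightarrow> marg \<Rightarrow> real \<Rightarrow> marg" where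
  "emp_init n d E C \<eta> = \<lparr>
     vx = (\<lambda>i x. if i < n \<and> x < d
                 then exp (- \<eta> * vx C i x) / (\<Sum>z<d. exp (- \<eta> * vx C i z)) else 0),
     ed = (\<lambda>e x y. if e \<in> E \<and> x < d \<and> y < d
                 then exp (- \<eta> * ed C e x y) / (\<Sum>u<d. \<Sum>v<d. exp (- \<eta> * ed C e u v)) else 0) \<rparr>"

definition left_cons :: "nat \<Rightarrow> nat \<times> nat \<Rightarrow> marg \<Rightarrow> marg" where
  "left_cons d e G = (let i = fst e; r = (\<lambda>a. \<Sum>z<d. ed G e a z) in
     G \<lparr> ed := (ed G)(e := (\<lambda>a b. ed G e a b * sqrt (vx G i a / r a))),
         vx := (vx G)(i := (\<lambda>a. vx G i a * sqrt (r a / vx G i a))) \<rparr>)"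

definition right_cons :: "nat \<Rightarrow> nat \<times> nat \<Rightarrow> marg \<Rightarrow> marg" where
  "right_cons d e G = (let j = snd e; c = (\<lambda>b. \<Sum>z<d. ed G e z b) in
     G \<lparr> ed := (ed G)(e := (\<lambda>a b. ed G e a b * sqrt (vx G j b / c b))),
         vx := (vx G)(j := (\<lambda>b. vx G j b * sqrt (c b / vx G j b))) \<rparr>)"

definition normalize_at :: "nat \<Rightarrow> nat \<Rightarrow> nat \<times> nat \<Rightarrow> marg \<Rightarrow> marg" where
  "normalize_at d i e G =
     G \<lparr> vx := (vx G)(i := (\<lambda>a. vx G i a / (\<Sum>z<d. vx G i z))),
         ed := (ed G)(e := (\<lambda>a b. ed G e a b / (\<Sum>u<d. \<Sum>v<d. ed G e u v))) \<rparr>"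

definition left_norm :: "nat \<Rightarrow> nat \<times> nat \<Rightarrow> marg \<Rightarrow> marg" where
  "left_norm d e = normalize_at d (fst e) e"

definition right_norm :: "nat \<Rightarrow> nat \<times> nat \<Rightarrow> marg \<Rightarrow> marg" where
  "right_norm d e = normalize_at d (snd e) e"

definition left_viol :: "nat \<Rightarrow> nat \<times> nat \<Rightarrow> marg \<Rightarrow> real" where
  "left_viol d e G = (\<Sum>a<d. \<bar>(\<Sum>b<d. ed G e a b) - vx G (fst e) a\<bar>)"

definition right_viol :: "nat \<Rightarrow> nat \<times> nat \<Rightarrow> marg \<Rightarrow> real" where
  "right_viol d e G = (\<Sum>b<d. \<bar>(\<Sum>a<d. ed G e a b) - vx G (snd e) b\<bar>)"

definition emp_stopped :: "nat \<Rightarrow> (nat \<times> nat) set \<Rightarrow> real \<Rightarrow> marg \<Rightarrow> bool" where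
  "emp_stopped d E \<epsilon> G \<longleftrightarrow> (\<forall>e\<in>E. left_viol d e G < \<epsilon> \<and> right_viol d e G < \<epsilon>)"

definition emp_cyclic_iter :: "nat \<Rightarrow> (nat \<times> nat) list \<Rightarrow> marg \<Rightarrow> marg" where
  "emp_cyclic_iter d es = fold (\<lambda>e. right_norm d e \<circ> right_cons d e \<circ> left_norm d e \<circ> left_cons d e) es"

text \<open>One iteration of EMP-greedy (ties between maximal violations broken arbitrarily,
  hence a relation).\<close>
definition emp_greedy_step :: "nat \<Rightarrow> (nat \<times> nat) set \<Rightarrow> marg \<Rightarrow> marg \<Rightarrow> bool" where
  "emp_greedy_step d E G G' \<longleftrightarrow> (\<exists>e\<in>E.
     ((\<forall>e'\<in>E. left_viol d e' G \<le> left_viol d e G \<and> right_viol d e' G \<le> left_viol d e G) \<and>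
        G' = left_norm d e (left_cons d e G)) \<or>
     ((\<forall>e'\<in>E. left_viol d e' G \<le> right_viol d e G \<and> right_viol d e' G \<le> right_viol d e G) \<and>
        G' = right_norm d e (right_cons d e G)))"

definition returns_MAP_within ::
  "nat \<Rightarrow> nat \<Rightarrow> (nat \<times> nat) set \<Rightarrow> marg \<Rightarrow> real \<Rightarrow> (nat \<Rightarrow> marg) \<Rightarrow> nat \<Rightarrow> bool" where
  "returns_MAP_within n d E C \<epsilon> Gs N \<longleftrightarrow>
     (\<exists>k\<le>N. emp_stopped d E \<epsilon> (Gs k) \<and> (\<forall>k'<k. \<not> emp_stopped d E \<epsilon> (Gs k')) \<and>
            (\<forall>x. rounding_of n d (Gs k) x \<longrightarrow> is_MAP n d E C x))"

end

theory Submission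
  imports Defs
begin

text \<open>
  Every consistency-plus-normalization step replaces a vertex marginal \<open>v\<close> and the corresponding
  edge marginal \<open>r\<close> by their normalized geometric mean. With \<open>Z = \<Sum> sqrt (v r)\<close>, it decreases the
  Kullback-Leibler divergence from \<^emph>\<open>every\<close> point of the local polytope by the same amount
  \<open>- 2 ln Z\<close>, which is at least a quarter of the squared violation. Testing with the uniform point,
  whose initial divergence is at most \<open>S0\<close>, bounds the number of iterations; for the cyclic variant
  a violation present at the start of a sweep is charged, by Cauchy-Schwarz, to the at most
  \<open>deg + 1\<close> steps of the sweep that affect it.

  Since the decrease does not depend on the point, any iterate \<open>G\<close> satisfies
  \<open>\<langle>ln G, T - V\<rangle> = - \<eta> \<langle>C, T - V\<rangle>\<close> for \<open>T\<close>, \<open>V\<close> in the polytope. Take for \<open>V\<close> the unique optimal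
  vertex, which is integral, and for \<open>T\<close> a feasible point close to the stopped iterate. The left-hand
  side is at least minus the cross entropy of \<open>T\<close>, whereas \<open>\<langle>C, T - V\<rangle>\<close> is at least \<open>Delta\<close> times the
  weight that \<open>T\<close> puts on the other vertices. That weight is therefore at most a quarter, and each
  vertex marginal of \<open>G\<close> has its majority at the MAP state.
\<close>

subsection \<open>Inequalities for finite sums and distributions\<close>

lemma sum_change_one:
  fixes f g :: "'a \<Rightarrow> real"
  assumes "finite I" "k \<in> I" "\<And>i. i \<in> I \<Longrightarrow> i \<noteq> k \<Longrightarrow> g i = f i"
  shows "sum g I = sum f I + (g k - f k)"
proof -
  have "sum g (I - {k}) = sum f (I - {k})" using assms(3) by (intro sum.cong) auto
  then show ?thesis using assms(1,2) by (simp add: sum.remove[of I k])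
qed

text \<open>Cauchy-Schwarz for a sum of square roots, one summand at a time: if \<open>x\<close> is
  controlled by \<open>K\<close> terms of total \<open>T\<close>, a further term 2 sqrt g raises the
  count to \<open>K + 1\<close> and the total to \<open>T + g\<close>. The cross term is absorbed by
  2 sqrt (K g T) \<le> K g + T.\<close>

lemma sq_le_accumulate:
  fixes v x K T g :: real
  assumes x: "x\<^sup>2 \<le> 4 * K * T" and nonneg: "0 \<le> K" "0 \<le> T" "0 \<le> g" "0 \<le> v" and v: "v \<le> x + 2 * sqrt g"
  shows "v\<^sup>2 \<le> 4 * (K + 1) * (T + g)"
proof -
  have "x \<le> sqrt (4 * K * T)" using x by (rule real_le_rsqrt)
  then have "v \<le> 2 * (sqrt (K * T) + sqrt g)" using v by (simp add: real_sqrt_mult)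
  then have "v\<^sup>2 \<le> (2 * (sqrt (K * T) + sqrt g))\<^sup>2" using nonneg(4) by (rule power_mono)
  also have "\<dots> = 4 * (K * T + g + 2 * (sqrt (K * g) * sqrt T))"
    using nonneg by (simp add: power_mult_distrib power2_sum real_sqrt_mult)
  also have "2 * (sqrt (K * g) * sqrt T) \<le> K * g + T"
    using sum_squares_bound[of "sqrt (K * g)" "sqrt T"] nonneg by simp
  finally show ?thesis by (simp add: algebra_simps)
qed

text \<open>Factor p - q as (sqrt p - sqrt q) (sqrt p + sqrt q) and apply Cauchy-Schwarz: the
  squared factors sum to 2 - 2 Z and 2 + 2 Z, where Z \<le> 1 is the Bhattacharyya coefficient. The
  quantity 2 - 2 Z is a squared Hellinger distance.\<close>

lemma sum_abs_diff_sq_le_affinity: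
  fixes p q :: "'a \<Rightarrow> real"
  assumes fin: "finite I" and p: "\<And>a. a \<in> I \<Longrightarrow> 0 < p a" and q: "\<And>a. a \<in> I \<Longrightarrow> 0 < q a"
    and sp: "sum p I = 1" and sq: "sum q I = 1"
  shows "(\<Sum>a\<in>I. \<bar>p a - q a\<bar>)\<^sup>2 \<le> 4 * (2 - 2 * (\<Sum>a\<in>I. sqrt (p a * q a)))"
proof -
  let ?Z = "\<Sum>a\<in>I. sqrt (p a * q a)"
  have "\<bar>p a - q a\<bar> = \<bar>sqrt (p a) - sqrt (q a)\<bar> * (sqrt (p a) + sqrt (q a))" if "a \<in> I" for a
  proof -
    have "p a - q a = (sqrt (p a) - sqrt (q a)) * (sqrt (p a) + sqrt (q a))"
      using p[OF that] q[OF that] by (simp add: algebra_simps flip: power2_eq_square)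
    moreover have "0 \<le> sqrt (p a) + sqrt (q a)"
      using p[OF that] q[OF that] by simp
    ultimately show ?thesis by (metis abs_mult abs_of_nonneg)
  qed
  then have "(\<Sum>a\<in>I. \<bar>p a - q a\<bar>)\<^sup>2
      = (\<Sum>a\<in>I. \<bar>sqrt (p a) - sqrt (q a)\<bar> * (sqrt (p a) + sqrt (q a)))\<^sup>2" by simp
  also have "\<dots> \<le> (\<Sum>a\<in>I. \<bar>sqrt (p a) - sqrt (q a)\<bar>\<^sup>2) * (\<Sum>a\<in>I. (sqrt (p a) + sqrt (q a))\<^sup>2)"
    by (rule Cauchy_Schwarz_ineq_sum)
  also have "(\<Sum>a\<in>I. \<bar>sqrt (p a) - sqrt (q a)\<bar>\<^sup>2) = (\<Sum>a\<in>I. p a + q a - 2 * sqrt (p a * q a))"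
    using p q by (intro sum.cong) (auto simp: power2_diff real_sqrt_mult less_imp_le)
  also have "\<dots> = 2 - 2 * ?Z"
    by (simp add: sum.distrib sum_subtractf sp sq sum_distrib_left)
  also have "(\<Sum>a\<in>I. (sqrt (p a) + sqrt (q a))\<^sup>2) = (\<Sum>a\<in>I. p a + q a + 2 * sqrt (p a * q a))"
    using p q by (intro sum.cong) (auto simp: power2_sum real_sqrt_mult less_imp_le)
  also have "\<dots> = 2 + 2 * ?Z"
    by (simp add: sum.distrib sp sq sum_distrib_left)
  finally have *: "(\<Sum>a\<in>I. \<bar>p a - q a\<bar>)\<^sup>2 \<le> (2 - 2 * ?Z) * (2 + 2 * ?Z)" .
  have "?Z \<le> (\<Sum>a\<in>I. (p a + q a) / 2)"
    using p q by (intro sum_mono arith_geo_mean_sqrt) (auto simp: less_imp_le)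
  also have "\<dots> = 1" by (simp add: sum.distrib sp sq flip: sum_divide_distrib)
  finally have "?Z \<le> 1" .
  then have "(2 - 2 * ?Z) * (2 + 2 * ?Z) \<le> (2 - 2 * ?Z) * 4"
    by (intro mult_left_mono) auto
  with * show ?thesis by simp
qed

text \<open>Termwise from ln t \<le> t - 1 at t = sqrt (q / p). Together with
  \<open>sum_abs_diff_sq_le_affinity\<close> this yields a Pinsker-type inequality with constant
  4.\<close>

lemma KL_ge_affinity:
  fixes p q :: "'a \<Rightarrow> real"
  assumes p: "\<And>a. a \<in> I \<Longrightarrow> 0 < p a" and q: "\<And>a. a \<in> I \<Longrightarrow> 0 < q a"
    and sp: "sum p I = 1"
  shows "2 - 2 * (\<Sum>a\<in>I. sqrt (p a * q a)) \<le> (\<Sum>a\<in>I. p a * (ln (p a) - ln (q a)))"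
proof -
  have "2 * p a - 2 * sqrt (p a * q a) \<le> p a * (ln (p a) - ln (q a))" if "a \<in> I" for a
  proof -
    have pos: "0 < p a" "0 < q a" using p q that by auto
    have "ln (sqrt (q a / p a)) \<le> sqrt (q a / p a) - 1"
      using pos by (intro ln_le_minus_one) simp
    then have "(ln (q a) - ln (p a)) / 2 \<le> sqrt (q a / p a) - 1"
      using pos by (simp add: ln_sqrt ln_div)
    then have "p a * ((ln (q a) - ln (p a)) / 2) \<le> p a * (sqrt (q a / p a) - 1)"
      using pos by (intro mult_left_mono) auto
    moreover have "p a * sqrt (q a / p a) = sqrt (p a * q a)"
      using pos by (simp add: real_sqrt_mult real_sqrt_divide field_simps)
    ultimately show ?thesis by (simp add: field_simps)
  qed
  then have "(\<Sum>a\<in>I. 2 * p a - 2 * sqrt (p a * q a)) \<le> (\<Sum>a\<in>I. p a * (ln (p a) - ln (q a)))"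
    by (rule sum_mono)
  then show ?thesis by (simp add: sum_subtractf sp flip: sum_distrib_left)
qed

text \<open>The normalized geometric mean w satisfies KL(w, v) + KL(w, r) = - 2 ln Z. Both
  divergences are nonnegative, so each is at most - 2 ln Z, and the Pinsker-type inequality bounds
  the distance from w to either input. The distance between the inputs uses 2 - 2 Z \<le> - 2 ln
  Z.\<close>

lemma geometric_mean_displacement:
  fixes v r :: "'a \<Rightarrow> real"
  assumes fin: "finite I" "I \<noteq> {}" and v: "\<And>a. a \<in> I \<Longrightarrow> 0 < v a" and r: "\<And>a. a \<in> I \<Longrightarrow> 0 < r a"
    and sv: "sum v I = 1" and sr: "sum r I = 1"
  defines "Z \<equiv> \<Sum>a\<in>I. sqrt (v a * r a)"
  shows "0 < Z"
    and "(\<Sum>a\<in>I. \<bar>v a - r a\<bar>)\<^sup>2 \<le> 4 * (- 2 * ln Z)"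
    and "(\<Sum>a\<in>I. \<bar>sqrt (v a * r a) / Z - v a\<bar>)\<^sup>2 \<le> 4 * (- 2 * ln Z)"
    and "(\<Sum>a\<in>I. \<bar>sqrt (v a * r a) / Z - r a\<bar>)\<^sup>2 \<le> 4 * (- 2 * ln Z)"
proof -
  show Z: "0 < Z" unfolding Z_def using fin v r by (intro sum_pos) auto
  have "ln Z \<le> Z - 1" using Z by (rule ln_le_minus_one)
  moreover have "(\<Sum>a\<in>I. \<bar>v a - r a\<bar>)\<^sup>2 \<le> 4 * (2 - 2 * Z)"
    unfolding Z_def by (rule sum_abs_diff_sq_le_affinity) (use assms in auto)
  ultimately show "(\<Sum>a\<in>I. \<bar>v a - r a\<bar>)\<^sup>2 \<le> 4 * (- 2 * ln Z)" by simp
  define w where "w = (\<lambda>a. sqrt (v a * r a) / Z)"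
  have w: "0 < w a" if "a \<in> I" for a unfolding w_def using v r Z that by simp
  have sw: "sum w I = 1" unfolding w_def using Z by (simp add: Z_def flip: sum_divide_distrib)
  let ?Kv = "\<Sum>a\<in>I. w a * (ln (w a) - ln (v a))" and ?Kr = "\<Sum>a\<in>I. w a * (ln (w a) - ln (r a))"
  have "?Kv + ?Kr = (\<Sum>a\<in>I. w a * (- 2 * ln Z))"
    unfolding sum.distrib[symmetric]
  proof (rule sum.cong[OF refl])
    fix a assume "a \<in> I"
    then have "ln (w a) = (ln (v a) + ln (r a)) / 2 - ln Z"
      unfolding w_def using v[of a] r[of a] Z by (simp add: ln_div ln_sqrt ln_mult)
    then have "(ln (w a) - ln (v a)) + (ln (w a) - ln (r a)) = - 2 * ln Z" by simp
    then show "w a * (ln (w a) - ln (v a)) + w a * (ln (w a) - ln (r a)) = w a * (- 2 * ln Z)"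
      by (simp only: distrib_left[symmetric])
  qed
  also have "\<dots> = - 2 * ln Z" by (simp only: sw mult_1 flip: sum_distrib_right)
  finally have K: "?Kv + ?Kr = - 2 * ln Z" .
  have v1: "(\<Sum>a\<in>I. \<bar>w a - v a\<bar>)\<^sup>2 \<le> 4 * ?Kv"
    using sum_abs_diff_sq_le_affinity[OF fin(1) w v sw sv] KL_ge_affinity[of I w v, OF w v sw]
    by simp
  have r1: "(\<Sum>a\<in>I. \<bar>w a - r a\<bar>)\<^sup>2 \<le> 4 * ?Kr"
    using sum_abs_diff_sq_le_affinity[OF fin(1) w r sw sr] KL_ge_affinity[of I w r, OF w r sw]
    by simp
  have "0 \<le> ?Kv" "0 \<le> ?Kr" using v1 r1 zero_le_power2 by (smt (verit))+
  with v1 r1 K show "(\<Sum>a\<in>I. \<bar>sqrt (v a * r a) / Z - v a\<bar>)\<^sup>2 \<le> 4 * (- 2 * ln Z)"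
    "(\<Sum>a\<in>I. \<bar>sqrt (v a * r a) / Z - r a\<bar>)\<^sup>2 \<le> 4 * (- 2 * ln Z)"
    unfolding w_def by linarith+
qed

text \<open>Ratio test of the simplex method: \<open>s\<close> is the least ratio
  \<open>p c / - q c\<close> over the coordinates with negative \<open>q\<close>. The support
  condition makes every such ratio positive, and a minimizing coordinate drops to zero.\<close>

lemma max_nonneg_step:
  fixes p q :: "'a \<Rightarrow> real"
  assumes fin: "finite I" and p: "\<And>c. c \<in> I \<Longrightarrow> 0 \<le> p c"
    and supp: "\<And>c. c \<in> I \<Longrightarrow> p c = 0 \<Longrightarrow> q c = 0" and neg: "\<exists>c\<in>I. q c < 0"
  obtains s c where "0 < s" "\<And>c. c \<in> I \<Longrightarrow> 0 \<le> p c + s * q c" "c \<in> I" "p c \<noteq> 0" "p c + s * q c = 0"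
proof -
  define N where "N = {c \<in> I. q c < 0}"
  have N: "finite N" "N \<noteq> {}" using fin neg by (auto simp: N_def)
  define s where "s = Min ((\<lambda>c. p c / - q c) ` N)"
  have "s \<in> (\<lambda>c. p c / - q c) ` N" unfolding s_def using N by (intro Min_in) auto
  then obtain c where c: "c \<in> N" "s = p c / - q c" by auto
  have pc: "0 < p c'" if "c' \<in> N" for c'
    using that p[of c'] supp[of c'] by (force simp: N_def)
  have "0 \<le> p c' + s * q c'" if "c' \<in> I" for c'
  proof (cases "q c' < 0")
    case True
    then have "s \<le> p c' / - q c'" unfolding s_def using N that by (intro Min_le) (auto simp: N_def)
    then have "s * - q c' \<le> p c'" using True by (subst (asm) pos_le_divide_eq) auto
    then show ?thesis by simp
  next
    case False
    moreover have "0 \<le> s" using c pc[OF c(1)] by (auto simp: N_def divide_le_0_iff)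
    ultimately show ?thesis using p[OF that] by simp
  qed
  moreover have "0 < s" unfolding c(2) using c pc[OF c(1)] by (auto simp: N_def intro!: divide_pos_neg)
  moreover have "p c + s * q c = 0" "c \<in> I" "p c \<noteq> 0" using c pc[OF c(1)] by (auto simp: N_def)
  ultimately show ?thesis using that by blast
qed

text \<open>Nonnegativity of the Kullback-Leibler divergence from the uniform distribution to the
  Gibbs distribution with weights exp (- u).\<close>

lemma log_sum_exp_mean_ge:
  fixes u :: "'a \<Rightarrow> real"
  assumes "finite I" "I \<noteq> {}"
  shows "ln (card I) \<le> ln (\<Sum>c\<in>I. exp (- u c)) + (\<Sum>c\<in>I. u c) / card I"
proof -
  define Z where "Z = (\<Sum>c\<in>I. exp (- u c))"
  have Z: "0 < Z" unfolding Z_def using assms by (intro sum_pos) auto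
  have N: "0 < real (card I)" using assms by (simp add: card_gt_0_iff)
  have "(\<Sum>c\<in>I. ln (real (card I)) - u c - ln Z) \<le> (\<Sum>c\<in>I. real (card I) * exp (- u c) / Z - 1)"
  proof (rule sum_mono)
    fix c
    have "ln (real (card I) * exp (- u c) / Z) \<le> real (card I) * exp (- u c) / Z - 1"
      using Z N by (intro ln_le_minus_one) simp
    then show "ln (real (card I)) - u c - ln Z \<le> real (card I) * exp (- u c) / Z - 1"
      using Z N by (simp add: ln_mult ln_div)
  qed
  also have "\<dots> = 0"
    using Z by (simp add: sum_subtractf flip: sum_distrib_left sum_divide_distrib Z_def)
  finally have "real (card I) * (ln (real (card I)) - ln Z) \<le> (\<Sum>c\<in>I. u c)"
    by (simp add: sum_subtractf sum.distrib algebra_simps)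
  then have "ln (real (card I)) - ln Z \<le> (\<Sum>c\<in>I. u c) / card I"
    using N by (simp add: field_simps)
  then show ?thesis by (simp add: Z_def)
qed

lemma log_sum_exp_plus_mean_le:
  fixes u :: "'a \<Rightarrow> real"
  assumes "finite I" "I \<noteq> {}" "\<And>c. c \<in> I \<Longrightarrow> \<bar>u c\<bar> \<le> M"
  shows "ln (\<Sum>c\<in>I. exp (- u c)) + (\<Sum>c\<in>I. u c) / card I \<le> ln (card I) + 2 * M"
proof -
  have N: "0 < real (card I)" using assms by (simp add: card_gt_0_iff)
  have Z: "0 < (\<Sum>c\<in>I. exp (- u c))" using assms by (intro sum_pos) auto
  have "(\<Sum>c\<in>I. exp (- u c)) \<le> (\<Sum>c\<in>I. exp M)" using assms(3) by (intro sum_mono) force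
  then have "ln (\<Sum>c\<in>I. exp (- u c)) \<le> ln (real (card I) * exp M)" using Z by (subst ln_le_cancel_iff) (auto simp: N)
  also have "\<dots> = ln (card I) + M" using N by (simp add: ln_mult)
  finally have 1: "ln (\<Sum>c\<in>I. exp (- u c)) \<le> ln (card I) + M" .
  have "(\<Sum>c\<in>I. u c) \<le> (\<Sum>c\<in>I. M)" using assms(3) by (intro sum_mono) force
  then have "(\<Sum>c\<in>I. u c) / card I \<le> M" using N by (simp add: divide_le_eq mult.commute)
  with 1 show ?thesis by simp
qed

lemma neg_mult_ln_le_one:
  fixes p :: real
  assumes "0 < p"
  shows "- (ln p * p) \<le> 1"
proof -
  have "ln (1 / p) \<le> 1 / p - 1" using assms by (intro ln_le_minus_one) simp
  then have "- ln p * p \<le> (1 / p - 1) * p" using assms by (intro mult_right_mono) (auto simp: ln_div)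
  also have "\<dots> = 1 - p" using assms by (simp add: field_simps)
  finally show ?thesis using assms by simp
qed

subsection \<open>Geometry of the local polytope\<close>

text \<open>One index type for vertex and edge entries, so that supports, signs and linear
  functionals can be handled uniformly.\<close>

fun coord :: "marg \<Rightarrow> (nat \<times> nat) + ((nat \<times> nat) \<times> nat \<times> nat) \<Rightarrow> real" where
  "coord G (Inl (i, x)) = vx G i x"
| "coord G (Inr (e, x, y)) = ed G e x y"

lemma coord_eqI: "(\<And>c. coord A c = coord B c) \<Longrightarrow> A = B"
proof -
  assume *: "\<And>c. coord A c = coord B c"
  have "vx A = vx B" using *[of "Inl (_, _)"] by (auto intro!: ext)
  moreover have "ed A = ed B"
  proof (intro ext)
    fix e x y show "ed A e x y = ed B e x y" using *[of "Inr (e, x, y)"] by simp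
  qed
  ultimately show ?thesis by simp
qed

lemma coord_comb_m [simp]: "coord (comb_m t A B) c = t * coord A c + (1 - t) * coord B c"
  by (cases c) (auto simp: comb_m_def)

definition shift_m :: "real \<Rightarrow> marg \<Rightarrow> marg \<Rightarrow> marg \<Rightarrow> marg" where
  "shift_m s P A B = \<lparr> vx = (\<lambda>i x. vx P i x + s * (vx A i x - vx B i x)),
                       ed = (\<lambda>e x y. ed P e x y + s * (ed A e x y - ed B e x y)) \<rparr>"

lemma coord_shift_m [simp]: "coord (shift_m s P A B) c = coord P c + s * (coord A c - coord B c)"
  by (cases c) (auto simp: shift_m_def)

locale local_polytope =
  fixes n d :: nat and E :: "(nat \<times> nat) set"
  assumes finite_E: "finite E" and d_pos: "1 \<le> d"
    and edges: "\<And>e. e \<in> E \<Longrightarrow> fst e < n \<and> snd e < n \<and> fst e \<noteq> snd e"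
begin

definition Idx :: "((nat \<times> nat) + ((nat \<times> nat) \<times> nat \<times> nat)) set" where
  "Idx = ({..<n} \<times> {..<d}) <+> (E \<times> {..<d} \<times> {..<d})"

lemma mem_Idx:
  "Inl (i, x) \<in> Idx \<longleftrightarrow> i < n \<and> x < d"
  "Inr (e, x, y) \<in> Idx \<longleftrightarrow> e \<in> E \<and> x < d \<and> y < d"
  by (auto simp: Idx_def)

lemma finite_Idx: "finite Idx"
  unfolding Idx_def using finite_E by auto

lemma sum_Idx:
  "(\<Sum>c\<in>Idx. f c) = (\<Sum>i<n. \<Sum>x<d. f (Inl (i, x))) + (\<Sum>e\<in>E. \<Sum>x<d. \<Sum>y<d. f (Inr (e, x, y)))"
  unfolding Idx_def using finite_E
  by (subst sum.Plus) (auto simp: sum.cartesian_product case_prod_beta comp_def)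

lemma inner_m_Idx: "inner_m n d E C G = (\<Sum>c\<in>Idx. coord C c * coord G c)"
  by (simp add: inner_m_def sum_Idx)

lemma inner_m_comb:
  "inner_m n d E C (comb_m t A B) = t * inner_m n d E C A + (1 - t) * inner_m n d E C B"
  unfolding inner_m_Idx by (simp add: algebra_simps sum.distrib sum_distrib_left sum_subtractf)

lemma L2_coord:
  assumes "G \<in> L2 n d E"
  shows L2_nonneg: "0 \<le> coord G c" and L2_outside: "c \<notin> Idx \<Longrightarrow> coord G c = 0"
proof -
  have "0 \<le> coord G c \<and> (c \<notin> Idx \<longrightarrow> coord G c = 0)"
  proof (cases c)
    case (Inl p)
    obtain i x where "p = (i, x)" by (cases p)
    moreover have "(i < n \<and> x < d \<longrightarrow> 0 \<le> vx G i x) \<and> (\<not> (i < n \<and> x < d) \<longrightarrow> vx G i x = 0)"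
      using assms unfolding L2_def by simp
    ultimately show ?thesis using Inl unfolding Idx_def
      by (cases "i < n \<and> x < d") auto
  next
    case (Inr p)
    obtain e x y where "p = (e, x, y)" by (cases p)
    moreover have "(e \<in> E \<and> x < d \<and> y < d \<longrightarrow> 0 \<le> ed G e x y) \<and>
        (\<not> (e \<in> E \<and> x < d \<and> y < d) \<longrightarrow> ed G e x y = 0)"
      using assms unfolding L2_def by blast
    ultimately show ?thesis using Inr unfolding Idx_def
      by (cases "e \<in> E \<and> x < d \<and> y < d") auto
  qed
  then show "0 \<le> coord G c" "c \<notin> Idx \<Longrightarrow> coord G c = 0" by auto
qed

lemma L2_vertex_sum: "G \<in> L2 n d E \<Longrightarrow> i < n \<Longrightarrow> (\<Sum>x<d. vx G i x) = 1"
  by (simp add: L2_def)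

lemma L2_row: "G \<in> L2 n d E \<Longrightarrow> e \<in> E \<Longrightarrow> x < d \<Longrightarrow> (\<Sum>y<d. ed G e x y) = vx G (fst e) x"
  by (cases e) (auto simp: L2_def)

lemma L2_col: "G \<in> L2 n d E \<Longrightarrow> e \<in> E \<Longrightarrow> y < d \<Longrightarrow> (\<Sum>x<d. ed G e x y) = vx G (snd e) y"
  by (cases e) (auto simp: L2_def)

lemma L2_edge_sum: "G \<in> L2 n d E \<Longrightarrow> e \<in> E \<Longrightarrow> (\<Sum>x<d. \<Sum>y<d. ed G e x y) = 1"
  using L2_row[of G e] L2_vertex_sum[of G "fst e"] edges[of e] by simp

lemma L2I:
  assumes nonneg: "\<And>c. c \<in> Idx \<Longrightarrow> 0 \<le> coord G c" and out: "\<And>c. c \<notin> Idx \<Longrightarrow> coord G c = 0"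
    and "\<And>i. i < n \<Longrightarrow> (\<Sum>x<d. vx G i x) = 1"
    and "\<And>e x. e \<in> E \<Longrightarrow> x < d \<Longrightarrow> (\<Sum>y<d. ed G e x y) = vx G (fst e) x"
    and "\<And>e y. e \<in> E \<Longrightarrow> y < d \<Longrightarrow> (\<Sum>x<d. ed G e x y) = vx G (snd e) y"
  shows "G \<in> L2 n d E"
proof -
  have "(i < n \<and> x < d \<longrightarrow> 0 \<le> vx G i x) \<and> (\<not> (i < n \<and> x < d) \<longrightarrow> vx G i x = 0)" for i x
    using nonneg[of "Inl (i, x)"] out[of "Inl (i, x)"] by (auto simp: Idx_def)
  moreover have "(e \<in> E \<and> x < d \<and> y < d \<longrightarrow> 0 \<le> ed G e x y) \<and>
      (\<not> (e \<in> E \<and> x < d \<and> y < d) \<longrightarrow> ed G e x y = 0)" for e x y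
    using nonneg[of "Inr (e, x, y)"] out[of "Inr (e, x, y)"] by (auto simp: Idx_def)
  moreover have "\<forall>(i, j)\<in>E. (\<forall>x<d. (\<Sum>y<d. ed G (i, j) x y) = vx G i x) \<and>
      (\<forall>y<d. (\<Sum>x<d. ed G (i, j) x y) = vx G j y)"
    using assms(4,5) by fastforce
  ultimately show ?thesis unfolding L2_def using assms(3) by blast
qed

lemma L2_coord_sum: "G \<in> L2 n d E \<Longrightarrow> (\<Sum>c\<in>Idx. coord G c) = real n + real (card E)"
  by (simp add: sum_Idx L2_vertex_sum L2_edge_sum)

text \<open>The direction \<open>A - B\<close> solves the homogeneous form of all equality
  constraints, so only the signs remain to be checked.\<close>

lemma shift_m_in_L2:
  assumes "P \<in> L2 n d E" "A \<in> L2 n d E" "B \<in> L2 n d E"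
    and "\<And>c. c \<in> Idx \<Longrightarrow> 0 \<le> coord (shift_m s P A B) c"
  shows "shift_m s P A B \<in> L2 n d E"
proof (rule L2I)
  show "c \<notin> Idx \<Longrightarrow> coord (shift_m s P A B) c = 0" for c
    using assms(1-3) by (simp add: L2_outside)
qed (use assms in \<open>auto simp: shift_m_def sum.distrib sum_subtractf L2_vertex_sum L2_row L2_col
           simp flip: sum_distrib_left\<close>)

section \<open>Supports, faces and vertices of the local polytope\<close>

definition supp_m :: "marg \<Rightarrow> ((nat \<times> nat) + ((nat \<times> nat) \<times> nat \<times> nat)) set" where
  "supp_m P = {c \<in> Idx. coord P c \<noteq> 0}"

lemma finite_supp_m: "finite (supp_m P)"
  unfolding supp_m_def using finite_Idx by simp

text \<open>All points of the polytope have the same coordinate sum, so a nonzero direction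
  \<open>A - B\<close> has a negative entry and the ratio test applies. The direction vanishes off
  the support of \<open>P\<close>: no coordinate enters the support, and the blocking one leaves
  it.\<close>

lemma L2_shift_to_boundary:
  assumes P: "P \<in> L2 n d E" and A: "A \<in> L2 n d E" and B: "B \<in> L2 n d E" and "A \<noteq> B"
    and supp: "\<And>c. coord P c = 0 \<Longrightarrow> coord A c = coord B c"
  obtains s where "0 < s" "shift_m s P A B \<in> L2 n d E" "supp_m (shift_m s P A B) \<subset> supp_m P"
proof -
  have neg: "\<exists>c\<in>Idx. coord A c - coord B c < 0"
  proof (rule ccontr)
    assume "\<not> ?thesis"
    then have ge: "0 \<le> coord A c - coord B c" if "c \<in> Idx" for c using that by (auto simp: not_less)
    have "(\<Sum>c\<in>Idx. coord A c - coord B c) = 0"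
      using L2_coord_sum[OF A] L2_coord_sum[OF B] by (simp add: sum_subtractf)
    then have "coord A c - coord B c = 0" if "c \<in> Idx" for c
      using sum_nonneg_eq_0_iff[OF finite_Idx, of "\<lambda>c. coord A c - coord B c"] ge that by blast
    then have "A = B" using L2_outside[OF A] L2_outside[OF B] by (intro coord_eqI) force
    with \<open>A \<noteq> B\<close> show False ..
  qed
  obtain s c where s: "0 < s" "\<And>c. c \<in> Idx \<Longrightarrow> 0 \<le> coord P c + s * (coord A c - coord B c)"
    and c: "c \<in> Idx" "coord P c \<noteq> 0" "coord P c + s * (coord A c - coord B c) = 0"
    by (rule max_nonneg_step[OF finite_Idx, of "coord P" "\<lambda>c. coord A c - coord B c"])
       (use L2_nonneg[OF P] supp neg in auto)
  show ?thesis
  proof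
    show "0 < s" by fact
    show "shift_m s P A B \<in> L2 n d E" using s P A B by (intro shift_m_in_L2) auto
    show "supp_m (shift_m s P A B) \<subset> supp_m P"
      using c supp unfolding supp_m_def by (auto simp: psubset_eq)
  qed
qed

text \<open>Follow the line through \<open>P\<close> with direction \<open>A - B\<close> both ways
  up to the boundary; \<open>P\<close> lies strictly between the two points reached.\<close>

lemma L2_split:
  assumes P: "P \<in> L2 n d E" and A: "A \<in> L2 n d E" and B: "B \<in> L2 n d E" and "A \<noteq> B"
    and supp: "\<And>c. coord P c = 0 \<Longrightarrow> coord A c = coord B c"
  obtains P1 P2 t where "P1 \<in> L2 n d E" "P2 \<in> L2 n d E" "0 < t" "t < 1" "P = comb_m t P1 P2"
    "supp_m P1 \<subset> supp_m P" "supp_m P2 \<subset> supp_m P"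
proof -
  obtain s1 where s1: "0 < s1" "shift_m s1 P A B \<in> L2 n d E" "supp_m (shift_m s1 P A B) \<subset> supp_m P"
    using L2_shift_to_boundary[OF P A B \<open>A \<noteq> B\<close> supp] by blast
  obtain s2 where s2: "0 < s2" "shift_m s2 P B A \<in> L2 n d E" "supp_m (shift_m s2 P B A) \<subset> supp_m P"
    using L2_shift_to_boundary[OF P B A \<open>A \<noteq> B\<close>[symmetric]] supp by metis
  \<comment> \<open>Chosen so that the opposite displacements \<open>s1\<close> and
    \<open>s2\<close> cancel.\<close>
  define t where "t = s2 / (s1 + s2)"
  have t: "0 < t" "t < 1" "1 - t = s1 / (s1 + s2)" using s1(1) s2(1) by (auto simp: t_def field_simps)
  have "t * s1 = (1 - t) * s2" unfolding t(3) by (simp add: t_def)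
  then have "t * s1 * (coord A c - coord B c) = (1 - t) * s2 * (coord A c - coord B c)" for c by simp
  then have "coord P c = coord (comb_m t (shift_m s1 P A B) (shift_m s2 P B A)) c" for c
    by (simp add: algebra_simps)
  then have "P = comb_m t (shift_m s1 P A B) (shift_m s2 P B A)" by (rule coord_eqI)
  then show ?thesis by (rule that[OF s1(2) s2(2) t(1,2) _ s1(3) s2(3)])
qed

text \<open>Otherwise \<open>L2_split\<close> writes \<open>V\<close> as a proper combination of
  points with smaller support, while extremality makes these points equal to
  \<open>V\<close>.\<close>

lemma vertex_not_split:
  assumes "V \<in> vertices_L2 n d E" "A \<in> L2 n d E" "B \<in> L2 n d E"
    and "\<And>c. coord V c = 0 \<Longrightarrow> coord A c = coord B c"
  shows "A = B"
proof (rule ccontr)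
  assume "A \<noteq> B"
  have V: "V \<in> L2 n d E" using assms(1) by (simp add: vertices_L2_def)
  obtain P1 P2 t where P: "P1 \<in> L2 n d E" "P2 \<in> L2 n d E" "0 < t" "t < 1" "V = comb_m t P1 P2"
    "supp_m P1 \<subset> supp_m V"
    by (rule L2_split[OF V assms(2,3) \<open>A \<noteq> B\<close> assms(4)]) (assumption, (rule that; assumption))
  then have "P1 = P2" using assms(1) unfolding vertices_L2_def by blast
  then have "coord V c = coord P1 c" for c by (subst P(5)) (simp add: algebra_simps)
  then have "V = P1" by (rule coord_eqI)
  with P(6) show False by simp
qed

text \<open>A vertex is determined by its support, a subset of the finite set \<open>Idx\<close>:
  two vertices with equal support vanish at the same places, so \<open>vertex_not_split\<close>
  applies to this very pair.\<close>

lemma finite_vertices_L2: "finite (vertices_L2 n d E)"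
proof (rule inj_on_finite)
  show "supp_m ` vertices_L2 n d E \<subseteq> Pow Idx" by (auto simp: supp_m_def)
  show "finite (Pow Idx)" using finite_Idx by simp
  show "inj_on supp_m (vertices_L2 n d E)"
  proof (rule inj_onI)
    fix V W assume VW: "V \<in> vertices_L2 n d E" "W \<in> vertices_L2 n d E" "supp_m V = supp_m W"
    then have "V \<in> L2 n d E" "W \<in> L2 n d E" by (auto simp: vertices_L2_def)
    then have "coord V c = coord W c" if "coord V c = 0" for c
      using that VW(3) L2_outside[of W c] by (cases "c \<in> Idx") (auto simp: supp_m_def)
    then show "V = W" using vertex_not_split[OF VW(1)] \<open>V \<in> L2 n d E\<close> \<open>W \<in> L2 n d E\<close> by blast
  qed
qed

text \<open>Every point is a convex combination of vertices, cast as an induction rule. The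
  induction is on the size of the support, which shrinks whenever a non-vertex is split.\<close>

lemma L2_induct_vertices [consumes 1, case_names vertex comb]:
  assumes "P \<in> L2 n d E"
    and vert: "\<And>V. V \<in> vertices_L2 n d E \<Longrightarrow> Q V"
    and conv: "\<And>A B t. A \<in> L2 n d E \<Longrightarrow> B \<in> L2 n d E \<Longrightarrow> 0 < t \<Longrightarrow> t < 1 \<Longrightarrow> Q A \<Longrightarrow> Q B \<Longrightarrow> Q (comb_m t A B)"
  shows "Q P"
  using assms(1)
proof (induction "card (supp_m P)" arbitrary: P rule: less_induct)
  case less
  show ?case
  proof (cases "P \<in> vertices_L2 n d E")
    case False
    with less.prems obtain A B t where AB: "A \<in> L2 n d E" "B \<in> L2 n d E" "0 < t" "t < 1"
      "P = comb_m t A B" "A \<noteq> B"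
      unfolding vertices_L2_def by blast
    \<comment> \<open>A combination of nonnegative numbers with positive weights vanishes only if
      both numbers do.\<close>
    have "coord A c = coord B c" if "coord P c = 0" for c
    proof -
      have "0 \<le> t * coord A c" "0 \<le> (1 - t) * coord B c"
        using AB L2_nonneg by simp_all
      moreover have "t * coord A c + (1 - t) * coord B c = 0" using that AB(5) by simp
      ultimately have "t * coord A c = 0" "(1 - t) * coord B c = 0" by linarith+
      then show ?thesis using AB(3,4) by simp
    qed
    then obtain P1 P2 u where P:
      "P1 \<in> L2 n d E" "P2 \<in> L2 n d E" "0 < u" "u < 1" "P = comb_m u P1 P2"
      "supp_m P1 \<subset> supp_m P" "supp_m P2 \<subset> supp_m P"
      by (rule L2_split[OF less.prems AB(1,2,6)]) (assumption, (rule that; assumption))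
    then show ?thesis
      using conv less.hyps psubset_card_mono[OF finite_supp_m] by metis
  qed (rule vert)
qed

text \<open>Coordinates of feasible points lie in [0, 1], so integral ones are 0 or 1, the extreme
  points of that interval.\<close>

lemma integral_is_vertex:
  assumes G: "G \<in> L2 n d E" and int: "integral_m G"
  shows "G \<in> vertices_L2 n d E"
proof -
  have le1: "coord A c \<le> 1" if A: "A \<in> L2 n d E" for A c
  proof (cases "c \<in> Idx")
    case False then show ?thesis using L2_outside[OF A] by simp
  next
    case True
    have vx: "vx A i x \<le> 1" if "i < n" "x < d" for i x
      using member_le_sum[of x "{..<d}" "vx A i"] L2_vertex_sum[OF A, of i]
        L2_nonneg[OF A, of "Inl (i, _)"] that by simp
    have "ed A e x y \<le> 1" if "e \<in> E" "x < d" "y < d" for e x y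
      using member_le_sum[of y "{..<d}" "ed A e x"] L2_row[OF A, of e x] vx[of "fst e" x]
        L2_nonneg[OF A, of "Inr (e, _, _)"] edges[of e] that by simp
    with vx True show ?thesis unfolding Idx_def by auto
  qed
  have int: "coord G c \<in> \<int>" for c
    using int by (cases c) (auto simp: integral_m_def)
  have "A = B" if AB: "A \<in> L2 n d E" "B \<in> L2 n d E" "0 < t" "t < 1" "G = comb_m t A B" for A B t
  proof (rule coord_eqI)
    fix c
    have eq: "coord G c = t * coord A c + (1 - t) * coord B c" using AB(5) by simp
    obtain k where k: "coord G c = of_int k" using int Ints_cases by blast
    with le1[OF G, of c] L2_nonneg[OF G, of c] have "k = 0 \<or> k = 1" by auto
    then show "coord A c = coord B c"
    proof
      assume "k = 0"
      moreover have "0 \<le> t * coord A c" "0 \<le> (1 - t) * coord B c"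
        using AB L2_nonneg by simp_all
      ultimately have "t * coord A c = 0" "(1 - t) * coord B c = 0" using eq k by linarith+
      then show ?thesis using AB(3,4) by simp
    next
      assume "k = 1"
      then have "t * (1 - coord A c) + (1 - t) * (1 - coord B c) = 0" using eq k by (simp add: algebra_simps)
      moreover have "0 \<le> t * (1 - coord A c)" "0 \<le> (1 - t) * (1 - coord B c)"
        using AB le1 by simp_all
      ultimately have "t * (1 - coord A c) = 0" "(1 - t) * (1 - coord B c) = 0" by linarith+
      then show ?thesis using AB(3,4) by simp
    qed
  qed
  then show ?thesis using G unfolding vertices_L2_def by blast
qed

section \<open>Assignments as integral points of the polytope\<close>

definition indicator_m :: "(nat \<Rightarrow> nat) \<Rightarrow> marg" where
  "indicator_m y = \<lparr> vx = (\<lambda>i x. of_bool (i < n \<and> x < d \<and> x = y i)),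
     ed = (\<lambda>e a b. of_bool (e \<in> E \<and> a < d \<and> b < d \<and> a = y (fst e) \<and> b = y (snd e))) \<rparr>"

lemma indicator_m_in_L2:
  assumes y: "\<And>i. i < n \<Longrightarrow> y i < d"
  shows "indicator_m y \<in> L2 n d E"
proof (rule L2I)
  have single: "(\<Sum>x<d. of_bool (x = k \<and> Q) :: real) = of_bool Q" if "k < d" for k Q
  proof -
    have "(\<Sum>x<d. of_bool (x = k \<and> Q) :: real) = (\<Sum>x<d. if x = k then of_bool Q else 0)"
      by (rule sum.cong) auto
    then show ?thesis using that by simp
  qed
  show "0 \<le> coord (indicator_m y) c" for c
    by (cases c) (auto simp: indicator_m_def)
  show "c \<notin> Idx \<Longrightarrow> coord (indicator_m y) c = 0" for c
    by (cases c) (auto simp: indicator_m_def Idx_def)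
  show "(\<Sum>x<d. vx (indicator_m y) i x) = 1" if "i < n" for i
  proof -
    have "(\<Sum>x<d. vx (indicator_m y) i x) = (\<Sum>x<d. of_bool (x = y i \<and> True))"
      using that by (intro sum.cong) (auto simp: indicator_m_def)
    then show ?thesis by (simp only: single[OF y[OF that]] of_bool_eq)
  qed
  show "(\<Sum>b<d. ed (indicator_m y) e a b) = vx (indicator_m y) (fst e) a" if "e \<in> E" "a < d" for e a
  proof -
    have "(\<Sum>b<d. ed (indicator_m y) e a b) = (\<Sum>b<d. of_bool (b = y (snd e) \<and> a = y (fst e)))"
      using that by (intro sum.cong) (auto simp: indicator_m_def)
    also have "\<dots> = of_bool (a = y (fst e))" using edges[OF that(1)] by (intro single y) simp
    finally show ?thesis using edges[OF that(1)] that by (simp add: indicator_m_def)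
  qed
  show "(\<Sum>a<d. ed (indicator_m y) e a b) = vx (indicator_m y) (snd e) b" if "e \<in> E" "b < d" for e b
  proof -
    have "(\<Sum>a<d. ed (indicator_m y) e a b) = (\<Sum>a<d. of_bool (a = y (fst e) \<and> b = y (snd e)))"
      using that by (intro sum.cong) (auto simp: indicator_m_def)
    also have "\<dots> = of_bool (b = y (snd e))" using edges[OF that(1)] by (intro single y) simp
    finally show ?thesis using edges[OF that(1)] that by (simp add: indicator_m_def)
  qed
qed

lemma inner_indicator_m:
  assumes y: "\<And>i. i < n \<Longrightarrow> y i < d"
  shows "inner_m n d E C (indicator_m y) = energy n E C y"
proof -
  have single: "(\<Sum>x<d. f x * of_bool (x = k)) = f k" if "k < d" for f :: "nat \<Rightarrow> real" and k
  proof -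
    have "(\<Sum>x<d. f x * of_bool (x = k)) = (\<Sum>x<d. if x = k then f x else 0)"
      by (rule sum.cong) auto
    then show ?thesis using that by simp
  qed
  have "(\<Sum>i<n. \<Sum>x<d. vx C i x * vx (indicator_m y) i x) = (\<Sum>i<n. vx C i (y i))"
  proof (rule sum.cong[OF refl])
    fix i assume "i \<in> {..<n}"
    then have "(\<Sum>x<d. vx C i x * vx (indicator_m y) i x) = (\<Sum>x<d. vx C i x * of_bool (x = y i))"
      by (intro sum.cong) (auto simp: indicator_m_def)
    then show "(\<Sum>x<d. vx C i x * vx (indicator_m y) i x) = vx C i (y i)"
      using single y \<open>i \<in> {..<n}\<close> by simp
  qed
  moreover have "(\<Sum>e\<in>E. \<Sum>a<d. \<Sum>b<d. ed C e a b * ed (indicator_m y) e a b)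
      = (\<Sum>e\<in>E. ed C e (y (fst e)) (y (snd e)))"
  proof (rule sum.cong[OF refl])
    fix e assume e: "e \<in> E"
    have "(\<Sum>a<d. \<Sum>b<d. ed C e a b * ed (indicator_m y) e a b)
      = (\<Sum>a<d. (\<Sum>b<d. ed C e a b * of_bool (b = y (snd e))) * of_bool (a = y (fst e)))"
      using e by (intro sum.cong refl) (auto simp: indicator_m_def sum_distrib_right)
    also have "\<dots> = ed C e (y (fst e)) (y (snd e))"
      using edges[OF e] y by (simp add: single)
    finally show "(\<Sum>a<d. \<Sum>b<d. ed C e a b * ed (indicator_m y) e a b) = ed C e (y (fst e)) (y (snd e))" .
  qed
  ultimately show ?thesis
    by (simp add: inner_m_def energy_def case_prod_beta)
qed

text \<open>Each vertex marginal is a 0/1 vector of sum one and selects a state. Zero marginals then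
  annihilate all other rows and columns of an edge matrix, which leaves a single entry of mass
  one.\<close>

lemma integral_L2_eq_indicator:
  assumes G: "G \<in> L2 n d E" and int: "integral_m G"
  obtains y where "\<And>i. i < n \<Longrightarrow> y i < d" "G = indicator_m y"
proof -
  have ex: "\<exists>x<d. vx G i x = 1" if "i < n" for i
  proof (rule ccontr)
    assume no: "\<not> ?thesis"
    have "vx G i x = 0" if x: "x < d" for x
    proof -
      obtain k where k: "vx G i x = of_int k" using int Ints_cases unfolding integral_m_def by blast
      have "vx G i x \<le> 1"
        using member_le_sum[of x "{..<d}" "vx G i"] L2_vertex_sum[OF G \<open>i < n\<close>]
          L2_nonneg[OF G, of "Inl (i, _)"] x by simp
      moreover have "0 \<le> vx G i x" using L2_nonneg[OF G, of "Inl (i, x)"] by simp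
      ultimately have "k = 0 \<or> k = 1" using k by auto
      then show ?thesis using no x k by auto
    qed
    then show False using L2_vertex_sum[OF G that] by simp
  qed
  define y where "y = (\<lambda>i. SOME x. x < d \<and> vx G i x = 1)"
  have y: "y i < d" "vx G i (y i) = 1" if "i < n" for i
    using someI_ex[OF ex[OF that]] unfolding y_def by auto
  have vx0: "vx G i x = 0" if "i < n" "x < d" "x \<noteq> y i" for i x
  proof -
    have "(\<Sum>x\<in>{..<d} - {y i}. vx G i x) = 0"
      using L2_vertex_sum[OF G that(1)] y[OF that(1)] by (simp add: sum_diff1)
    then have "\<forall>x\<in>{..<d} - {y i}. vx G i x = 0"
      using L2_nonneg[OF G, of "Inl (i, _)"] by (subst (asm) sum_nonneg_eq_0_iff) auto
    then show ?thesis using that by auto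
  qed
  have row0: "ed G e a b = 0" if "e \<in> E" "a < d" "b < d" "a \<noteq> y (fst e)" for e a b
  proof -
    have "(\<Sum>b<d. ed G e a b) = 0" using L2_row[OF G, of e a] vx0 edges that by simp
    then have "\<forall>b<d. ed G e a b = 0"
      using L2_nonneg[OF G, of "Inr (e, a, _)"] by (subst (asm) sum_nonneg_eq_0_iff) auto
    then show ?thesis using that by auto
  qed
  have col0: "ed G e a b = 0" if "e \<in> E" "a < d" "b < d" "b \<noteq> y (snd e)" for e a b
  proof -
    have "(\<Sum>a<d. ed G e a b) = 0" using L2_col[OF G, of e b] vx0 edges that by simp
    then have "\<forall>a<d. ed G e a b = 0"
      using L2_nonneg[OF G, of "Inr (e, _, b)"] by (subst (asm) sum_nonneg_eq_0_iff) auto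
    then show ?thesis using that by auto
  qed
  have one: "ed G e (y (fst e)) (y (snd e)) = 1" if e: "e \<in> E" for e
  proof -
    have lt: "y (fst e) < d" "y (snd e) < d" using edges[OF e] y by auto
    have "(\<Sum>b<d. ed G e (y (fst e)) b) = (\<Sum>b<d. if b = y (snd e) then ed G e (y (fst e)) b else 0)"
      using col0[OF e lt(1)] by (intro sum.cong) auto
    then show ?thesis using L2_row[OF G e lt(1)] y(2)[of "fst e"] edges[OF e] lt by simp
  qed
  have "G = indicator_m y"
  proof (rule coord_eqI)
    fix c show "coord G c = coord (indicator_m y) c"
    proof (cases "c \<in> Idx")
      case False
      then show ?thesis
        using L2_outside[OF G] L2_outside[OF indicator_m_in_L2[of y]] y by simp
    next
      case True
      then show ?thesis using y(2) vx0 row0 col0 one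
        by (cases c) (auto simp: Idx_def indicator_m_def)
    qed
  qed
  with y(1) show ?thesis using that by blast
qed

text \<open>The number \<open>l\<close> is the weight of \<open>V\<close> in some decomposition of
  \<open>P\<close> into vertices: 1 at \<open>V\<close>, 0 at every other vertex, and combined
  affinely. What remains of \<open>P\<close> is nonnegative and consists of vertices worse than
  \<open>V\<close> by at least \<open>\<delta>\<close>.\<close>

lemma unique_optimum_gap:
  assumes opt: "opt_vertices n d E C = {V}"
  defines "\<delta> \<equiv> real_of_ereal (min (Delta n d E C) (ereal (1/128)))"
  shows "0 < \<delta>"
    and "P \<in> L2 n d E \<Longrightarrow> \<exists>l\<le>1. (\<forall>c. l * coord V c \<le> coord P c) \<and>
           inner_m n d E C V + \<delta> * (1 - l) \<le> inner_m n d E C P"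
proof -
  let ?gaps = "(\<lambda>W. ereal (inner_m n d E C W - inner_m n d E C V)) ` (vertices_L2 n d E - {V})"
  have Delta: "Delta n d E C = Inf ?gaps"
    unfolding Delta_def opt by (rule arg_cong[where f = Inf]) auto
  have V: "V \<in> vertices_L2 n d E" "lp_optimal n d E C V"
    using opt by (auto simp: opt_vertices_def)
  have pos: "inner_m n d E C V < inner_m n d E C W" if "W \<in> vertices_L2 n d E - {V}" for W
  proof -
    have "W \<in> L2 n d E" "\<not> lp_optimal n d E C W"
      using that opt by (auto simp: opt_vertices_def vertices_L2_def)
    then show ?thesis using V(2) unfolding lp_optimal_def by force
  qed
  have fin: "finite ?gaps" using finite_vertices_L2 by simp
  have "0 < Delta n d E C"
  proof (cases "?gaps = {}")
    case False
    then have "Delta n d E C \<in> ?gaps" unfolding Delta using fin by (metis Min_Inf Min_in)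
    then obtain W where "W \<in> vertices_L2 n d E - {V}"
      "Delta n d E C = ereal (inner_m n d E C W - inner_m n d E C V)" by blast
    then show ?thesis using pos[of W] by simp
  next
    case True
    then show ?thesis unfolding Delta by (simp only: Inf_empty) (simp add: top_ereal_def)
  qed
  \<comment> \<open>The cap 1/128 keeps the minimum finite even when \<open>Delta\<close> is
    \<infinity>, so \<open>real_of_ereal\<close> loses nothing.\<close>
  then have \<delta>: "ereal \<delta> = min (Delta n d E C) (ereal (1/128))"
    unfolding \<delta>_def by (cases "Delta n d E C") (auto simp: min_def)
  moreover have "0 < min (Delta n d E C) (ereal (1/128))" using \<open>0 < Delta n d E C\<close> by simp
  ultimately show \<delta>_pos: "0 < \<delta>" by (metis ereal_less(2))
  have gap: "\<delta> \<le> inner_m n d E C W - inner_m n d E C V" if "W \<in> vertices_L2 n d E - {V}" for W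
  proof -
    have "ereal \<delta> \<le> Delta n d E C" unfolding \<delta> by simp
    also have "\<dots> \<le> ereal (inner_m n d E C W - inner_m n d E C V)"
      unfolding Delta using that by (intro Inf_lower) auto
    finally show ?thesis by simp
  qed
  assume "P \<in> L2 n d E"
  then show "\<exists>l\<le>1. (\<forall>c. l * coord V c \<le> coord P c) \<and>
           inner_m n d E C V + \<delta> * (1 - l) \<le> inner_m n d E C P"
  proof (induction rule: L2_induct_vertices)
    case (vertex W)
    show ?case
    proof (cases "W = V")
      case True then show ?thesis by (intro exI[of _ 1]) simp
    next
      case False
      then show ?thesis using vertex gap[of W] L2_nonneg[of W]
        by (intro exI[of _ 0]) (auto simp: vertices_L2_def)
    qed
  next
    case (comb A B t)
    then obtain l m where l: "l \<le> 1" "\<And>c. l * coord V c \<le> coord A c"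
        "inner_m n d E C V + \<delta> * (1 - l) \<le> inner_m n d E C A"
      and m: "m \<le> 1" "\<And>c. m * coord V c \<le> coord B c"
        "inner_m n d E C V + \<delta> * (1 - m) \<le> inner_m n d E C B" by blast
    show ?case
    proof (intro exI[of _ "t * l + (1 - t) * m"] conjI allI)
      show "t * l + (1 - t) * m \<le> 1"
        using convex_bound_le[of l 1 m t "1 - t"] l(1) m(1) comb by simp
      show "(t * l + (1 - t) * m) * coord V c \<le> coord (comb_m t A B) c" for c
      proof -
        have "(t * l + (1 - t) * m) * coord V c = t * (l * coord V c) + (1 - t) * (m * coord V c)"
          by (simp add: algebra_simps)
        also have "\<dots> \<le> t * coord A c + (1 - t) * coord B c"
          using comb l(2) m(2) by (intro add_mono mult_left_mono) auto
        finally show ?thesis by simp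
      qed
      show "inner_m n d E C V + \<delta> * (1 - (t * l + (1 - t) * m)) \<le> inner_m n d E C (comb_m t A B)"
      proof -
        have "inner_m n d E C V + \<delta> * (1 - (t * l + (1 - t) * m))
          = t * (inner_m n d E C V + \<delta> * (1 - l)) + (1 - t) * (inner_m n d E C V + \<delta> * (1 - m))"
          by (simp add: algebra_simps)
        also have "\<dots> \<le> t * inner_m n d E C A + (1 - t) * inner_m n d E C B"
          using comb l(3) m(3) by (intro add_mono mult_left_mono) auto
        finally show ?thesis by (simp add: inner_m_comb)
      qed
    qed
  qed
qed

end

subsection \<open>A single projection step\<close>

text \<open>The Boolean selects the endpoint of an edge: True is the left one, whose marginal is given by
  the rows of the edge matrix.\<close>

definition endpt :: "bool \<Rightarrow> nat \<times> nat \<Rightarrow> nat" where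
  "endpt s e = (if s then fst e else snd e)"

definition edm :: "bool \<Rightarrow> marg \<Rightarrow> nat \<times> nat \<Rightarrow> nat \<Rightarrow> nat \<Rightarrow> real" where
  "edm s G e a b = (if s then ed G e a b else ed G e b a)"

text \<open>Consistency and normalization on one side of one edge, as a single operation: one greedy
  iteration is one half-step, and a sweep consists of two half-steps per edge.\<close>

definition half_step :: "nat \<Rightarrow> bool \<times> (nat \<times> nat) \<Rightarrow> marg \<Rightarrow> marg" where
  "half_step d o' G = (if fst o' then left_norm d (snd o') (left_cons d (snd o') G)
                       else right_norm d (snd o') (right_cons d (snd o') G))"

definition ln_m :: "marg \<Rightarrow> marg" where
  "ln_m G = \<lparr> vx = (\<lambda>i x. ln (vx G i x)), ed = (\<lambda>e x y. ln (ed G e x y)) \<rparr>"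

context local_polytope
begin

text \<open>The invariant of the iteration. Strict positivity gives meaning to logarithms and
  quotients; agreement between edge and vertex marginals is not demanded.\<close>

definition normalized_m :: "marg \<Rightarrow> bool" where
  "normalized_m G \<longleftrightarrow>
     (\<forall>i<n. (\<forall>x<d. 0 < vx G i x) \<and> (\<Sum>x<d. vx G i x) = 1) \<and>
     (\<forall>e\<in>E. (\<forall>x<d. \<forall>y<d. 0 < ed G e x y) \<and> (\<Sum>x<d. \<Sum>y<d. ed G e x y) = 1)"

definition emarg :: "bool \<Rightarrow> nat \<times> nat \<Rightarrow> marg \<Rightarrow> nat \<Rightarrow> real" where
  "emarg s e G a = (\<Sum>b<d. edm s G e a b)"

definition viol :: "bool \<times> (nat \<times> nat) \<Rightarrow> marg \<Rightarrow> real" where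
  "viol o' G = (\<Sum>a<d. \<bar>vx G (endpt (fst o') (snd o')) a - emarg (fst o') (snd o') G a\<bar>)"

text \<open>The Bhattacharyya coefficient of the two marginals compared, and also the common
  normalizing constant of the vertex and the edge update.\<close>

definition affinity :: "bool \<times> (nat \<times> nat) \<Rightarrow> marg \<Rightarrow> real" where
  "affinity o' G = (\<Sum>a<d. sqrt (vx G (endpt (fst o') (snd o')) a * emarg (fst o') (snd o') G a))"

definition gain :: "bool \<times> (nat \<times> nat) \<Rightarrow> marg \<Rightarrow> real" where
  "gain o' G = - 2 * ln (affinity o' G)"

lemma viol_True: "viol (True, e) G = left_viol d e G"
  unfolding viol_def left_viol_def by (simp add: emarg_def edm_def endpt_def abs_minus_commute)

lemma viol_False: "viol (False, e) G = right_viol d e G"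
  unfolding viol_def right_viol_def by (simp add: emarg_def edm_def endpt_def abs_minus_commute)

lemma viol_nonneg: "0 \<le> viol o' G"
  unfolding viol_def by (intro sum_nonneg) auto

lemma endpt_less: "e \<in> E \<Longrightarrow> endpt s e < n"
  using edges[of e] by (simp add: endpt_def)

lemma sum_edm: "(\<Sum>a<d. \<Sum>b<d. h (edm s G e a b) (edm s H e a b)) = (\<Sum>x<d. \<Sum>y<d. h (ed G e x y) (ed H e x y))"
  by (cases s) (simp_all add: edm_def sum.swap[of "\<lambda>x y. h (ed G e y x) (ed H e y x)"])

lemma sum_emarg: "(\<Sum>a<d. emarg s e G a) = (\<Sum>x<d. \<Sum>y<d. ed G e x y)"
  unfolding emarg_def using sum_edm[of "\<lambda>x _. x"] by simp

context
  fixes G :: marg and e :: "nat \<times> nat" and s :: bool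
  assumes G: "normalized_m G" and e: "e \<in> E"
begin

lemma vertex_pos: "a < d \<Longrightarrow> 0 < vx G (endpt s e) a"
  using G endpt_less[OF e] by (simp add: normalized_m_def)

lemma edm_pos: "a < d \<Longrightarrow> b < d \<Longrightarrow> 0 < edm s G e a b"
  using G e by (simp add: normalized_m_def edm_def)

lemma emarg_pos: "a < d \<Longrightarrow> 0 < emarg s e G a"
  unfolding emarg_def using d_pos by (intro sum_pos edm_pos) (auto simp: lessThan_empty_iff)

lemma vertex_sum: "(\<Sum>a<d. vx G (endpt s e) a) = 1"
  using G endpt_less[OF e] by (simp add: normalized_m_def)

lemma emarg_sum: "(\<Sum>a<d. emarg s e G a) = 1"
  using G e by (simp add: sum_emarg normalized_m_def)

lemma states_nonempty: "{..<d} \<noteq> {}"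
  using d_pos by (auto simp: lessThan_empty_iff)

lemmas displacement = geometric_mean_displacement[OF finite_lessThan states_nonempty,
  of "vx G (endpt s e)" "emarg s e G", OF _ _ vertex_sum emarg_sum, simplified, OF vertex_pos emarg_pos]

lemma affinity_pos: "0 < affinity (s, e) G"
  using displacement(1) by (simp add: affinity_def)

lemma viol_sq_le_gain: "(viol (s, e) G)\<^sup>2 \<le> 4 * gain (s, e) G"
  using displacement(2) by (simp add: affinity_def gain_def viol_def)

lemma gain_nonneg: "0 \<le> gain (s, e) G"
  using viol_sq_le_gain zero_le_power2[of "viol (s, e) G"] by linarith

lemma half_step_vx:
  assumes "a < d"
  shows "vx (half_step d (s, e) G) (endpt s e) a
       = sqrt (vx G (endpt s e) a * emarg s e G a) / affinity (s, e) G"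
proof -
  have "vx G (endpt s e) a * sqrt (emarg s e G a / vx G (endpt s e) a)
      = sqrt (vx G (endpt s e) a * emarg s e G a)" if "a < d" for a
    using vertex_pos[OF that] by (simp add: real_sqrt_divide real_sqrt_mult field_simps)
  with assms show ?thesis
    by (cases s) (simp_all add: half_step_def left_norm_def right_norm_def normalize_at_def left_cons_def
        right_cons_def Let_def endpt_def emarg_def edm_def affinity_def)
qed

text \<open>Rescaling turns each row sum into the geometric mean of the two marginals, so the total
  mass of the edge equals that of the updated vertex.\<close>

lemma edm_weighted_sum:
  "(\<Sum>a<d. \<Sum>b<d. edm s G e a b * sqrt (vx G (endpt s e) a / emarg s e G a)) = affinity (s, e) G"
proof -
  have "(\<Sum>b<d. edm s G e a b * sqrt (vx G (endpt s e) a / emarg s e G a))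
      = sqrt (vx G (endpt s e) a * emarg s e G a)" if "a < d" for a
  proof -
    have "(\<Sum>b<d. edm s G e a b * sqrt (vx G (endpt s e) a / emarg s e G a))
        = emarg s e G a * sqrt (vx G (endpt s e) a / emarg s e G a)"
      by (simp add: emarg_def flip: sum_distrib_right)
    also have "\<dots> = sqrt (vx G (endpt s e) a * emarg s e G a)"
      using emarg_pos[OF that] by (simp add: real_sqrt_divide real_sqrt_mult field_simps)
    finally show ?thesis .
  qed
  then show ?thesis by (simp add: affinity_def)
qed

lemma half_step_edm:
  assumes "a < d" "b < d"
  shows "edm s (half_step d (s, e) G) e a b
       = edm s G e a b * sqrt (vx G (endpt s e) a / emarg s e G a) / affinity (s, e) G"
proof (cases s)
  case True
  then show ?thesis using edm_weighted_sum
    by (simp add: half_step_def left_norm_def normalize_at_def left_cons_def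
        Let_def endpt_def emarg_def edm_def)
next
  case False
  have "(\<Sum>x<d. \<Sum>y<d. ed G e x y * sqrt (vx G (snd e) y / (\<Sum>b<d. ed G e b y))) = affinity (s, e) G"
    using edm_weighted_sum False by (subst sum.swap) (simp add: edm_def endpt_def emarg_def)
  with False show ?thesis
    by (simp add: half_step_def right_norm_def normalize_at_def right_cons_def
        Let_def endpt_def emarg_def edm_def)
qed

lemma half_step_other_vx: "i \<noteq> endpt s e \<Longrightarrow> vx (half_step d (s, e) G) i = vx G i"
  by (simp add: half_step_def left_norm_def right_norm_def normalize_at_def left_cons_def
        right_cons_def Let_def endpt_def split: if_splits)

lemma half_step_other_ed: "e' \<noteq> e \<Longrightarrow> ed (half_step d (s, e) G) e' = ed G e'"
  by (simp add: half_step_def left_norm_def right_norm_def normalize_at_def left_cons_def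
        right_cons_def Let_def endpt_def split: if_splits)

lemma half_step_normalized: "normalized_m (half_step d (s, e) G)"
proof -
  let ?H = "half_step d (s, e) G"
  have v: "0 < vx ?H (endpt s e) a" if "a < d" for a
    using vertex_pos emarg_pos affinity_pos that by (simp add: half_step_vx)
  have vs: "(\<Sum>a<d. vx ?H (endpt s e) a) = 1"
    using affinity_pos by (simp add: half_step_vx affinity_def flip: sum_divide_distrib)
  have ep: "0 < edm s ?H e a b" if "a < d" "b < d" for a b
    using edm_pos vertex_pos emarg_pos affinity_pos that by (simp add: half_step_edm)
  have "(\<Sum>a<d. \<Sum>b<d. edm s ?H e a b) = 1"
    using affinity_pos edm_weighted_sum by (simp add: half_step_edm flip: sum_divide_distrib)
  then have es: "(\<Sum>x<d. \<Sum>y<d. ed ?H e x y) = 1" using sum_edm[of "\<lambda>x _. x"] by simp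
  have ep': "0 < ed ?H e a b" if "a < d" "b < d" for a b
    using ep[of a b] ep[of b a] that by (cases s) (auto simp: edm_def)
  have "(\<forall>x<d. 0 < vx ?H i x) \<and> (\<Sum>x<d. vx ?H i x) = 1" if "i < n" for i
    using v vs half_step_other_vx[of i] G that by (cases "i = endpt s e") (auto simp: normalized_m_def)
  moreover have "(\<forall>x<d. \<forall>y<d. 0 < ed ?H e' x y) \<and> (\<Sum>x<d. \<Sum>y<d. ed ?H e' x y) = 1" if "e' \<in> E" for e'
    using ep' es half_step_other_ed[of e'] G that by (cases "e' = e") (auto simp: normalized_m_def)
  ultimately show ?thesis unfolding normalized_m_def by blast
qed

text \<open>The logarithms change by (ln r - ln v) / 2 - ln Z at the vertex and by (ln v - ln r) / 2
  - ln Z along each row of the edge. Consistency of \<open>U\<close> collapses the edge sum to the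
  same vertex marginal, so the halves cancel and - 2 ln Z remains, whatever \<open>U\<close>
  is.\<close>

lemma inner_ln_half_step:
  assumes U: "U \<in> L2 n d E"
  shows "inner_m n d E (ln_m (half_step d (s, e) G)) U = inner_m n d E (ln_m G) U + gain (s, e) G"
proof -
  let ?H = "half_step d (s, e) G" and ?i = "endpt s e" and ?Z = "affinity (s, e) G"
  define v r where "v = vx G ?i" and "r = emarg s e G"
  have pos: "0 < v a" "0 < r a" if "a < d" for a
    using vertex_pos emarg_pos that by (auto simp: v_def r_def)
  define f where "f = (\<lambda>G i. \<Sum>x<d. vx (ln_m G) i x * vx U i x)"
  define h where "h = (\<lambda>G e'. \<Sum>x<d. \<Sum>y<d. ed (ln_m G) e' x y * ed U e' x y)"
  have Umarg: "(\<Sum>b<d. edm s U e a b) = vx U ?i a" if "a < d" for a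
    using L2_row[OF U e that] L2_col[OF U e that] by (simp add: edm_def endpt_def)
  have "f ?H ?i - f G ?i = (\<Sum>a<d. ((ln (r a) - ln (v a)) / 2 - ln ?Z) * vx U ?i a)"
    unfolding f_def sum_subtractf[symmetric]
  proof (rule sum.cong[OF refl])
    fix a assume "a \<in> {..<d}"
    then have "ln (vx ?H ?i a) = (ln (v a) + ln (r a)) / 2 - ln ?Z"
      using pos[of a] affinity_pos
      by (simp add: half_step_vx ln_div ln_sqrt ln_mult flip: v_def r_def)
    then have "ln (vx ?H ?i a) - ln (v a) = (ln (r a) - ln (v a)) / 2 - ln ?Z"
      by (simp add: field_simps)
    then show "vx (ln_m ?H) ?i a * vx U ?i a - vx (ln_m G) ?i a * vx U ?i a
        = ((ln (r a) - ln (v a)) / 2 - ln ?Z) * vx U ?i a"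
      by (simp add: ln_m_def v_def flip: left_diff_distrib)
  qed
  moreover have "h ?H e - h G e = (\<Sum>a<d. ((ln (v a) - ln (r a)) / 2 - ln ?Z) * vx U ?i a)"
  proof -
    have "h K e = (\<Sum>a<d. \<Sum>b<d. ln (edm s K e a b) * edm s U e a b)" for K
      unfolding h_def using sum_edm[of "\<lambda>x y. ln x * y" s K e U] by (simp add: ln_m_def)
    then have "h ?H e - h G e
        = (\<Sum>a<d. \<Sum>b<d. (ln (edm s ?H e a b) - ln (edm s G e a b)) * edm s U e a b)"
      by (simp add: left_diff_distrib sum_subtractf)
    also have "\<dots> = (\<Sum>a<d. \<Sum>b<d. ((ln (v a) - ln (r a)) / 2 - ln ?Z) * edm s U e a b)"
    proof (intro sum.cong refl)
      fix a b assume ab: "a \<in> {..<d}" "b \<in> {..<d}"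
      then have "ln (edm s ?H e a b) - ln (edm s G e a b) = (ln (v a) - ln (r a)) / 2 - ln ?Z"
        using pos[of a] affinity_pos edm_pos[of a b]
        by (simp add: half_step_edm ln_div ln_sqrt ln_mult flip: v_def r_def)
      then show "(ln (edm s ?H e a b) - ln (edm s G e a b)) * edm s U e a b
          = ((ln (v a) - ln (r a)) / 2 - ln ?Z) * edm s U e a b" by simp
    qed
    finally show ?thesis by (simp add: Umarg flip: sum_distrib_left)
  qed
  ultimately have "(f ?H ?i - f G ?i) + (h ?H e - h G e) = (\<Sum>a<d. - 2 * ln ?Z * vx U ?i a)"
    unfolding sum.distrib[symmetric] by (simp add: sum.distrib[symmetric] algebra_simps flip: add_divide_distrib)
  also have "\<dots> = gain (s, e) G"
    by (simp only: gain_def L2_vertex_sum[OF U endpt_less[OF e]] mult_1_right flip: sum_distrib_left)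
  finally have total: "(f ?H ?i - f G ?i) + (h ?H e - h G e) = gain (s, e) G" .
  have "sum (f ?H) {..<n} = sum (f G) {..<n} + (f ?H ?i - f G ?i)"
    using endpt_less[OF e] by (intro sum_change_one) (auto simp: f_def ln_m_def half_step_other_vx)
  moreover have "sum (h ?H) E = sum (h G) E + (h ?H e - h G e)"
    using finite_E e by (intro sum_change_one) (auto simp: h_def ln_m_def half_step_other_ed)
  ultimately show ?thesis using total by (simp add: inner_m_def f_def h_def)
qed

section \<open>How far a half-step moves marginals and violations\<close>

lemma half_step_displacement_vx:
  "(\<Sum>a<d. \<bar>vx (half_step d (s, e) G) (endpt s e) a - vx G (endpt s e) a\<bar>) \<le> 2 * sqrt (gain (s, e) G)"
proof -
  have "(\<Sum>a<d. \<bar>vx (half_step d (s, e) G) (endpt s e) a - vx G (endpt s e) a\<bar>)\<^sup>2 \<le> 4 * gain (s, e) G"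
    using displacement(3) by (simp add: half_step_vx gain_def affinity_def)
  from real_le_rsqrt[OF this] show ?thesis by (simp add: real_sqrt_mult)
qed

text \<open>All entries of a row are scaled by the same factor, so the matrix moves in the 1-norm
  exactly as far as its vector of row sums.\<close>

lemma half_step_displacement_edm:
  "(\<Sum>a<d. \<Sum>b<d. \<bar>edm s (half_step d (s, e) G) e a b - edm s G e a b\<bar>) \<le> 2 * sqrt (gain (s, e) G)"
proof -
  let ?Z = "affinity (s, e) G" and ?v = "vx G (endpt s e)" and ?r = "emarg s e G"
  have "(\<Sum>b<d. \<bar>edm s (half_step d (s, e) G) e a b - edm s G e a b\<bar>) = \<bar>sqrt (?v a * ?r a) / ?Z - ?r a\<bar>"
    if a: "a < d" for a
  proof -
    have "\<bar>edm s (half_step d (s, e) G) e a b - edm s G e a b\<bar>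
        = edm s G e a b * \<bar>sqrt (?v a / ?r a) / ?Z - 1\<bar>" if "b < d" for b
    proof -
      have "edm s (half_step d (s, e) G) e a b - edm s G e a b
        = edm s G e a b * (sqrt (?v a / ?r a) / ?Z - 1)"
        using a that by (simp add: half_step_edm algebra_simps)
      then show ?thesis using edm_pos[OF a that] by (simp add: abs_mult)
    qed
    then have "(\<Sum>b<d. \<bar>edm s (half_step d (s, e) G) e a b - edm s G e a b\<bar>)
        = ?r a * \<bar>sqrt (?v a / ?r a) / ?Z - 1\<bar>"
      by (simp add: emarg_def flip: sum_distrib_right)
    also have "\<dots> = \<bar>?r a * (sqrt (?v a / ?r a) / ?Z - 1)\<bar>"
      using emarg_pos[OF a] by (simp add: abs_mult)
    also have "?r a * (sqrt (?v a / ?r a) / ?Z - 1) = sqrt (?v a * ?r a) / ?Z - ?r a"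
    proof -
      have "?r a * sqrt (?v a / ?r a) = sqrt (?v a * ?r a)"
        using emarg_pos[OF a] by (simp add: real_sqrt_divide real_sqrt_mult field_simps)
      then show ?thesis by (simp add: right_diff_distrib)
    qed
    finally show ?thesis .
  qed
  then have "(\<Sum>a<d. \<Sum>b<d. \<bar>edm s (half_step d (s, e) G) e a b - edm s G e a b\<bar>)\<^sup>2 \<le> 4 * gain (s, e) G"
    using displacement(4) by (simp add: gain_def affinity_def)
  from real_le_rsqrt[OF this] show ?thesis by (simp add: real_sqrt_mult)
qed

end

text \<open>A different half-step disturbs at most one of the two vectors compared: the opposite
  side of the same edge changes only the matrix, since the endpoints differ, and another edge at the
  same vertex changes only the vertex marginal.\<close>

lemma viol_half_step:
  assumes G: "normalized_m G" and e: "e \<in> E" and e': "e' \<in> E" and ne: "(s', e') \<noteq> (s, e)"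
  shows "viol (s, e) G \<le> viol (s, e) (half_step d (s', e') G) +
     (if endpt s' e' = endpt s e \<or> e' = e then 2 * sqrt (gain (s', e') G) else 0)"
proof -
  let ?H = "half_step d (s', e') G" and ?i = "endpt s e"
  have tri: "viol (s, e) G \<le> viol (s, e) ?H + (\<Sum>a<d. \<bar>vx ?H ?i a - vx G ?i a\<bar>)
      + (\<Sum>a<d. \<bar>emarg s e ?H a - emarg s e G a\<bar>)"
    unfolding viol_def sum.distrib[symmetric] by (intro sum_mono) auto
  consider (edge) "e' = e" | (vertex) "e' \<noteq> e" "endpt s' e' = ?i" | (none) "e' \<noteq> e" "endpt s' e' \<noteq> ?i"
    by blast
  then show ?thesis
  proof cases
    case edge
    with ne have s': "s' = (\<not> s)" by auto
    have "?i \<noteq> endpt s' e'" using edges[OF e] s' edge by (auto simp: endpt_def)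
    then have "vx ?H ?i = vx G ?i" by (rule half_step_other_vx[OF G e'])
    moreover have "(\<Sum>a<d. \<bar>emarg s e ?H a - emarg s e G a\<bar>) \<le> 2 * sqrt (gain (s', e') G)"
    proof -
      have "(\<Sum>a<d. \<bar>emarg s e ?H a - emarg s e G a\<bar>) \<le> (\<Sum>a<d. \<Sum>b<d. \<bar>edm s ?H e a b - edm s G e a b\<bar>)"
        unfolding emarg_def sum_subtractf[symmetric] by (intro sum_mono sum_abs)
      also have "\<dots> = (\<Sum>a<d. \<Sum>b<d. \<bar>edm s' ?H e' a b - edm s' G e' a b\<bar>)"
        unfolding edge using sum_edm[of "\<lambda>x y. \<bar>x - y\<bar>"] by simp
      also have "\<dots> \<le> 2 * sqrt (gain (s', e') G)" by (rule half_step_displacement_edm[OF G e'])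
      finally show ?thesis .
    qed
    ultimately show ?thesis using tri edge by simp
  next
    case vertex
    then have "emarg s e ?H a = emarg s e G a" for a
      using half_step_other_ed[OF G e', of e s'] by (simp add: emarg_def edm_def cong: if_cong)
    then show ?thesis using tri half_step_displacement_vx[OF G e', of s'] vertex by simp
  next
    case none
    then have "emarg s e ?H a = emarg s e G a" for a
      using half_step_other_ed[OF G e', of e s'] by (simp add: emarg_def edm_def cong: if_cong)
    moreover have "vx ?H ?i = vx G ?i" using none half_step_other_vx[OF G e'] by metis
    ultimately show ?thesis using none by (simp add: viol_def)
  qed
qed

subsection \<open>Sweeps and iteration counts\<close>

text \<open>\<open>lifts g G H\<close>: passing from \<open>G\<close> to \<open>H\<close> decreases the Kullback-Leibler divergence from every
  point of the local polytope by the same amount \<open>g\<close>.\<close>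

definition lifts :: "real \<Rightarrow> marg \<Rightarrow> marg \<Rightarrow> bool" where
  "lifts g G H \<longleftrightarrow> normalized_m H \<and>
     (\<forall>U\<in>L2 n d E. inner_m n d E (ln_m H) U = inner_m n d E (ln_m G) U + g)"

lemma lifts_refl: "normalized_m G \<Longrightarrow> lifts 0 G G"
  by (simp add: lifts_def)

lemma lifts_trans: "lifts g G H \<Longrightarrow> lifts g' H K \<Longrightarrow> lifts (g + g') G K"
  by (simp add: lifts_def)

lemma lifts_half_step: "normalized_m G \<Longrightarrow> e \<in> E \<Longrightarrow> lifts (gain (s, e) G) G (half_step d (s, e) G)"
  by (simp add: lifts_def inner_ln_half_step half_step_normalized)

primrec gains :: "(bool \<times> (nat \<times> nat)) list \<Rightarrow> marg \<Rightarrow> real" where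
  "gains [] G = 0"
| "gains (o' # os) G = gain o' G + gains os (half_step d o' G)"

lemma lifts_sweep:
  assumes "normalized_m G" "snd ` set os \<subseteq> E"
  shows "lifts (gains os G) G (fold (half_step d) os G) \<and> 0 \<le> gains os G"
  using assms
proof (induction os arbitrary: G)
  case (Cons o' os)
  obtain s e where o': "o' = (s, e)" by (cases o')
  with Cons.prems have e: "e \<in> E" by auto
  let ?H = "half_step d (s, e) G"
  have "lifts (gains os ?H) ?H (fold (half_step d) os ?H) \<and> 0 \<le> gains os ?H"
    using Cons half_step_normalized[OF _ e] by simp
  then show ?case
    using lifts_trans[OF lifts_half_step[OF Cons.prems(1) e]] gain_nonneg[OF Cons.prems(1) e, of s] o'
    by auto
qed (simp add: lifts_refl)

text \<open>The half-steps \<open>q\<close> that can alter one of the two vectors compared by the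
  violation \<open>p\<close>, including \<open>p\<close> itself.\<close>

definition relevant :: "bool \<times> (nat \<times> nat) \<Rightarrow> bool \<times> (nat \<times> nat) \<Rightarrow> bool" where
  "relevant p q \<longleftrightarrow> endpt (fst q) (snd q) = endpt (fst p) (snd p) \<or> snd q = snd p"

text \<open>Until the first occurrence of \<open>(s, e)\<close> in the list, the violation shrinks
  by at most 2 sqrt(gain) at each relevant half-step and by nothing elsewhere; at that occurrence it
  is itself at most 2 sqrt(gain). \<open>sq_le_accumulate\<close> adds up these
  contributions.\<close>

lemma viol_sq_le_gains:
  assumes "normalized_m G" "snd ` set os \<subseteq> E" "(s, e) \<in> set os"
  shows "(viol (s, e) G)\<^sup>2 \<le> 4 * real (length (filter (relevant (s, e)) os)) * gains os G"
  using assms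
proof (induction os arbitrary: G)
  case (Cons o' os)
  obtain s' e' where o': "o' = (s', e')" by (cases o')
  with Cons.prems have e': "e' \<in> E" and e: "e \<in> E" by auto
  let ?H = "half_step d (s', e') G" and ?K = "real (length (filter (relevant (s, e)) os))"
  have H: "normalized_m ?H" by (rule half_step_normalized[OF Cons.prems(1) e'])
  have T: "0 \<le> gains os ?H" using lifts_sweep[OF H, of os] Cons.prems(2) by auto
  have g: "0 \<le> gain (s', e') G" by (rule gain_nonneg[OF Cons.prems(1) e'])
  show ?case
  proof (cases "o' = (s, e)")
    case True
    have "(viol (s, e) G)\<^sup>2 \<le> 4 * gain (s, e) G" by (rule viol_sq_le_gain[OF Cons.prems(1) e])
    also have "\<dots> \<le> 4 * gains (o' # os) G" using T True o' by simp
    also have "\<dots> \<le> 4 * (?K + 1) * gains (o' # os) G"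
      using T g True o' by (intro mult_right_mono) auto
    finally have "(viol (s, e) G)\<^sup>2 \<le> 4 * (?K + 1) * gains (o' # os) G" .
    moreover have "relevant (s, e) o'" using True by (simp add: relevant_def)
    ultimately show ?thesis by (simp add: add.commute)
  next
    case False
    then have IH: "(viol (s, e) ?H)\<^sup>2 \<le> 4 * ?K * gains os ?H" using Cons H by simp
    note step = viol_half_step[OF Cons.prems(1) e e', of s' s]
    show ?thesis
    proof (cases "relevant (s, e) o'")
      case True
      then have "viol (s, e) G \<le> viol (s, e) ?H + 2 * sqrt (gain (s', e') G)"
        using step False by (simp add: o' relevant_def)
      from sq_le_accumulate[OF IH _ T g viol_nonneg this]
      show ?thesis using True by (simp add: o' algebra_simps)
    next
      case False': False
      then have "viol (s, e) G \<le> viol (s, e) ?H" using step False by (simp add: o' relevant_def)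
      then have "(viol (s, e) G)\<^sup>2 \<le> (viol (s, e) ?H)\<^sup>2" using viol_nonneg by (rule power_mono)
      also note IH
      also have "4 * ?K * gains os ?H \<le> 4 * ?K * gains (o' # os) G"
        using g by (intro mult_left_mono) (auto simp: o')
      finally show ?thesis using False' by simp
    qed
  qed
qed simp

lemma degree_le_deg: "i < n \<Longrightarrow> card {e \<in> E. fst e = i \<or> snd e = i} \<le> deg n E"
  unfolding deg_def by (intro Max_ge) auto

text \<open>There is one half-step per edge at the vertex, because the endpoints of an edge differ,
  and one more for the opposite side of \<open>e\<close>.\<close>

lemma length_relevant:
  assumes "distinct os" "snd ` set os \<subseteq> E" "e \<in> E"
  shows "length (filter (relevant (s, e)) os) \<le> deg n E + 1"
proof -
  let ?i = "endpt s e" and ?A = "{q. snd q \<in> E \<and> endpt (fst q) (snd q) = endpt s e}"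
  have inj: "inj_on snd ?A"
    using edges by (fastforce simp: inj_on_def endpt_def split: if_splits)
  have sub: "snd ` ?A \<subseteq> {e \<in> E. fst e = ?i \<or> snd e = ?i}"
    by (auto simp: endpt_def split: if_splits)
  have fin: "finite ?A" using inj_on_finite[OF inj sub] finite_E by simp
  have "card ?A \<le> card {e \<in> E. fst e = ?i \<or> snd e = ?i}"
    using card_inj_on_le[OF inj sub] finite_E by simp
  also have "\<dots> \<le> deg n E" using assms(3) by (intro degree_le_deg endpt_less)
  finally have A: "card ?A \<le> deg n E" .
  have "set (filter (relevant (s, e)) os) \<subseteq> insert (\<not> s, e) ?A"
    using assms(2,3) by (auto simp: relevant_def) (metis (full_types))
  then have "card (set (filter (relevant (s, e)) os)) \<le> card (insert (\<not> s, e) ?A)"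
    using fin by (intro card_mono) auto
  also have "\<dots> \<le> card ?A + 1" using fin by (simp add: card_insert_if)
  finally show ?thesis
    unfolding distinct_card[OF distinct_filter[OF assms(1)]] using A by linarith
qed

section \<open>The potential and the stopping time\<close>

definition uniform_m :: marg where
  "uniform_m = \<lparr> vx = (\<lambda>i x. if i < n \<and> x < d then 1 / real d else 0),
     ed = (\<lambda>e x y. if e \<in> E \<and> x < d \<and> y < d then 1 / (real d)\<^sup>2 else 0) \<rparr>"

lemma uniform_m_in_L2: "uniform_m \<in> L2 n d E"
proof (rule L2I)
  show "0 \<le> coord uniform_m c" for c by (cases c) (auto simp: uniform_m_def)
  show "c \<notin> Idx \<Longrightarrow> coord uniform_m c = 0" for c
    by (cases c) (auto simp: uniform_m_def Idx_def split: if_splits)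
qed (use edges d_pos in \<open>auto simp: uniform_m_def power2_eq_square\<close>)

text \<open>Cross entropy of the uniform point relative to \<open>G\<close>. It exceeds the
  Kullback-Leibler divergence by the entropy of the uniform point, a constant, and is nonnegative
  because the entries of \<open>G\<close> are at most 1.\<close>

definition potential :: "marg \<Rightarrow> real" where
  "potential G = - inner_m n d E (ln_m G) uniform_m"

lemma normalized_coord:
  assumes "normalized_m G" "c \<in> Idx"
  shows "0 < coord G c" "coord G c \<le> 1"
proof -
  have vx: "0 < vx G i x \<and> vx G i x \<le> 1" if "i < n" "x < d" for i x
    using member_le_sum[of x "{..<d}" "vx G i"] assms(1) that by (auto simp: normalized_m_def less_imp_le)
  have ed: "0 < ed G e x y \<and> ed G e x y \<le> 1" if "e \<in> E" "x < d" "y < d" for e x y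
  proof -
    have pos: "\<And>x y. x < d \<Longrightarrow> y < d \<Longrightarrow> 0 < ed G e x y" using assms(1) that(1) by (simp add: normalized_m_def)
    have "ed G e x y \<le> (\<Sum>y<d. ed G e x y)"
      using pos that by (intro member_le_sum) (auto simp: less_imp_le)
    also have "\<dots> \<le> (\<Sum>x<d. \<Sum>y<d. ed G e x y)"
      using pos that by (intro member_le_sum[of x "{..<d}" "\<lambda>x. \<Sum>y<d. ed G e x y"])
        (auto intro!: sum_nonneg simp: less_imp_le)
    also have "\<dots> = 1" using assms(1) that(1) by (simp add: normalized_m_def)
    finally show ?thesis using pos that by simp
  qed
  show "0 < coord G c" "coord G c \<le> 1"
    using assms(2) vx ed unfolding Idx_def by (cases c; auto)+
qed

lemma coord_ln_m: "coord (ln_m G) c = ln (coord G c)"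
  by (cases c) (auto simp: ln_m_def)

lemma inner_ln_nonpos:
  assumes "normalized_m G" "U \<in> L2 n d E"
  shows "inner_m n d E (ln_m G) U \<le> 0"
  unfolding inner_m_Idx coord_ln_m
  using normalized_coord[OF assms(1)] L2_nonneg[OF assms(2)]
  by (intro sum_nonpos mult_nonpos_nonneg) auto

lemma potential_nonneg: "normalized_m G \<Longrightarrow> 0 \<le> potential G"
  using inner_ln_nonpos[OF _ uniform_m_in_L2] by (simp add: potential_def)

lemma potential_lifts: "lifts g G H \<Longrightarrow> potential H = potential G - g"
  using uniform_m_in_L2 by (simp add: lifts_def potential_def)

text \<open>Every iteration from an unstopped state costs at least \<open>c\<close> of a nonnegative
  potential that starts at most at \<open>S\<close>. The accumulated lift is kept in the conclusion
  because the analysis of the rounding needs it.\<close>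

lemma first_stop:
  assumes G0: "normalized_m (Gs 0)" and S: "potential (Gs 0) \<le> S" and c: "0 < c"
    and step: "\<And>k. normalized_m (Gs k) \<Longrightarrow> \<not> stop (Gs k) \<Longrightarrow> \<exists>g\<ge>c. lifts g (Gs k) (Gs (Suc k))"
  shows "\<exists>k\<le>nat \<lceil>S / c\<rceil>. stop (Gs k) \<and> (\<forall>k'<k. \<not> stop (Gs k')) \<and> (\<exists>g\<ge>0. lifts g (Gs 0) (Gs k))"
proof -
  have run: "\<exists>g\<ge>real k * c. lifts g (Gs 0) (Gs k)" if "\<forall>k'<k. \<not> stop (Gs k')" for k
    using that
  proof (induction k)
    case 0
    then show ?case using lifts_refl[OF G0] by auto
  next
    case (Suc k)
    then obtain g where g: "real k * c \<le> g" "lifts g (Gs 0) (Gs k)" by auto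
    moreover from g have "normalized_m (Gs k)" by (simp add: lifts_def)
    then obtain g' where "c \<le> g'" "lifts g' (Gs k) (Gs (Suc k))" using step[of k] Suc.prems by auto
    ultimately show ?case
      by (intro exI[of _ "g + g'"] conjI lifts_trans) (auto simp: distrib_right)
  qed
  let ?N = "nat \<lceil>S / c\<rceil>"
  have "\<exists>k\<le>?N. stop (Gs k)"
  proof (rule ccontr)
    assume "\<not> ?thesis"
    \<comment> \<open>No stop at the indices 0 to \<open>?N\<close> means \<open>?N + 1\<close>
      iterations, whose total gain exceeds \<open>S\<close> even if \<open>S / c\<close> is an
      integer.\<close>
    then obtain g where g: "real (Suc ?N) * c \<le> g" "lifts g (Gs 0) (Gs (Suc ?N))"
      using run[of "Suc ?N"] by (auto simp: less_Suc_eq_le)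
    have "S / c < real (Suc ?N)" by linarith
    then have "S < real (Suc ?N) * c" using c by (simp add: pos_divide_less_eq)
    then have "potential (Gs (Suc ?N)) < 0" using potential_lifts[OF g(2)] g(1) S by linarith
    moreover have "0 \<le> potential (Gs (Suc ?N))" using g(2) by (intro potential_nonneg) (simp add: lifts_def)
    ultimately show False by simp
  qed
  then obtain k where k: "k \<le> ?N" "stop (Gs k)" by blast
  define k0 where "k0 = (LEAST k. stop (Gs k))"
  have "stop (Gs k0)" "k0 \<le> k" "\<forall>k'<k0. \<not> stop (Gs k')"
    unfolding k0_def using k(2) by (auto intro: LeastI Least_le dest: not_less_Least)
  moreover from this(3) obtain g where "real k0 * c \<le> g" "lifts g (Gs 0) (Gs k0)" using run by blast
  moreover from this(1) have "0 \<le> g" using c by (meson less_imp_le mult_nonneg_nonneg of_nat_0_le_iff order_trans)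
  ultimately show ?thesis using k(1) by (meson order_trans)
qed

section \<open>Progress of one greedy and one cyclic iteration\<close>

lemma emp_stopped_viol:
  "emp_stopped d E \<epsilon> G \<longleftrightarrow> (\<forall>s. \<forall>e\<in>E. viol (s, e) G < \<epsilon>)"
  by (auto simp: emp_stopped_def viol_True viol_False all_bool_eq)

text \<open>The violation selected dominates the one that keeps the algorithm running, so it is at
  least \<epsilon>.\<close>

lemma greedy_step_lifts:
  assumes G: "normalized_m G" and "\<not> emp_stopped d E \<epsilon> G" and "0 < \<epsilon>" and "emp_greedy_step d E G G'"
  shows "\<exists>g\<ge>\<epsilon>\<^sup>2 / 4. lifts g G G'"
proof -
  from assms(2) obtain s e where e: "e \<in> E" "\<epsilon> \<le> viol (s, e) G" by (auto simp: emp_stopped_viol not_less)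
  from assms(4) obtain s' e' where e': "e' \<in> E" "\<forall>s. \<forall>e\<in>E. viol (s, e) G \<le> viol (s', e') G"
    "G' = half_step d (s', e') G"
    unfolding emp_greedy_step_def viol_True[symmetric] viol_False[symmetric] half_step_def all_bool_eq
    by (metis fst_conv snd_conv)
  have "\<epsilon>\<^sup>2 \<le> (viol (s', e') G)\<^sup>2" 
    using e e'(2) assms(3) order_trans by (intro power_mono) (blast, simp)
  also have "\<dots> \<le> 4 * gain (s', e') G" by (rule viol_sq_le_gain[OF G e'(1)])
  finally show ?thesis using lifts_half_step[OF G e'(1)] e'(3) by force
qed

lemma cyclic_iter_lifts:
  assumes G: "normalized_m G" and "\<not> emp_stopped d E \<epsilon> G" and "0 < \<epsilon>" and E: "E = set es" and "distinct es"
  shows "\<exists>g\<ge>\<epsilon>\<^sup>2 / (4 * (real (deg n E) + 1)). lifts g G (emp_cyclic_iter d es G)"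
proof -
  from assms(2) obtain s e where e: "e \<in> E" "\<epsilon> \<le> viol (s, e) G" by (auto simp: emp_stopped_viol not_less)
  \<comment> \<open>The sweep as a list of half-steps, left before right on each edge. Every side of
    every edge occurs in it, so an initial violation meets its own half-step.\<close>
  define os where "os = concat (map (\<lambda>e. [(True, e), (False, e)]) es)"
  have "fold (half_step d) (concat (map (\<lambda>e. [(True, e), (False, e)]) fs)) H = emp_cyclic_iter d fs H" for fs H
    by (induction fs arbitrary: H) (simp_all add: emp_cyclic_iter_def half_step_def)
  then have iter: "fold (half_step d) os G = emp_cyclic_iter d es G" by (simp add: os_def)
  have set_os: "set (concat (map (\<lambda>e. [(True, e), (False, e)]) fs)) = UNIV \<times> set fs" for fs :: "(nat \<times> nat) list"
    by (induction fs) (auto simp: UNIV_bool)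
  have "distinct (concat (map (\<lambda>e. [(True, e), (False, e)]) fs))" if "distinct fs" for fs :: "(nat \<times> nat) list"
    using that by (induction fs) (auto)
  then have dist: "distinct os" using assms(5) by (simp add: os_def)
  have os: "snd ` set os \<subseteq> E" "(s, e) \<in> set os" using set_os[of es] e(1) E by (auto simp: os_def)
  let ?g = "gains os G"
  have lift: "lifts ?g G (emp_cyclic_iter d es G)" "0 \<le> ?g" using lifts_sweep[OF G os(1)] iter by auto
  have "\<epsilon>\<^sup>2 \<le> (viol (s, e) G)\<^sup>2" using e assms(3) by (intro power_mono) auto
  also have "\<dots> \<le> 4 * real (length (filter (relevant (s, e)) os)) * ?g" by (rule viol_sq_le_gains[OF G os])
  also have "\<dots> \<le> 4 * (real (deg n E) + 1) * ?g"
    using length_relevant[OF dist os(1) e(1), of s] lift(2) by (intro mult_right_mono) auto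
  finally have "\<epsilon>\<^sup>2 / (4 * (real (deg n E) + 1)) \<le> ?g" by (simp add: divide_le_eq mult.commute)
  with lift show ?thesis by blast
qed

subsection \<open>The initial point\<close>

lemma normalized_emp_init: "normalized_m (emp_init n d E C \<eta>)"
proof -
  have "0 < (\<Sum>z<d. exp (- \<eta> * vx C i z))" for i
    using d_pos by (intro sum_pos) (auto simp: lessThan_empty_iff)
  moreover have "0 < (\<Sum>u<d. \<Sum>v<d. exp (- \<eta> * ed C e u v))" for e
    using d_pos by (intro sum_pos) (auto simp: lessThan_empty_iff)
  ultimately show ?thesis
    unfolding normalized_m_def emp_init_def
    by (auto simp: less_imp_neq[symmetric] simp flip: sum_divide_distrib)
qed

definition log_partition :: "marg \<Rightarrow> real \<Rightarrow> real" where
  "log_partition C \<eta> = (\<Sum>i<n. ln (\<Sum>x<d. exp (- \<eta> * vx C i x))) +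
                        (\<Sum>e\<in>E. ln (\<Sum>x<d. \<Sum>y<d. exp (- \<eta> * ed C e x y)))"

text \<open>Feasible points have mass one on each vertex and each edge, so the normalizers
  contribute the same constant for every \<open>U\<close>.\<close>

lemma inner_ln_emp_init:
  assumes U: "U \<in> L2 n d E"
  shows "inner_m n d E (ln_m (emp_init n d E C \<eta>)) U = - \<eta> * inner_m n d E C U - log_partition C \<eta>"
proof -
  let ?Zi = "\<lambda>i. \<Sum>z<d. exp (- \<eta> * vx C i z)" and ?Ze = "\<lambda>e. \<Sum>u<d. \<Sum>v<d. exp (- \<eta> * ed C e u v)"
  have Zi: "0 < ?Zi i" for i
    using d_pos by (intro sum_pos) (auto simp: lessThan_empty_iff)
  have Ze: "0 < ?Ze e" for e
    using d_pos by (intro sum_pos) (auto simp: lessThan_empty_iff)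
  have "(\<Sum>x<d. vx (ln_m (emp_init n d E C \<eta>)) i x * vx U i x)
      = - \<eta> * (\<Sum>x<d. vx C i x * vx U i x) - ln (?Zi i)" if "i < n" for i
  proof -
    have "(\<Sum>x<d. vx (ln_m (emp_init n d E C \<eta>)) i x * vx U i x)
        = (\<Sum>x<d. - \<eta> * (vx C i x * vx U i x) - ln (?Zi i) * vx U i x)"
      using that Zi[of i] by (intro sum.cong) (auto simp: ln_m_def emp_init_def ln_div algebra_simps)
    also have "\<dots> = - \<eta> * (\<Sum>x<d. vx C i x * vx U i x) - ln (?Zi i) * (\<Sum>x<d. vx U i x)"
      by (simp only: sum_subtractf sum_distrib_left)
    finally show ?thesis using L2_vertex_sum[OF U that] by simp
  qed
  moreover have "(\<Sum>x<d. \<Sum>y<d. ed (ln_m (emp_init n d E C \<eta>)) e x y * ed U e x y)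
      = - \<eta> * (\<Sum>x<d. \<Sum>y<d. ed C e x y * ed U e x y) - ln (?Ze e)" if "e \<in> E" for e
  proof -
    have "(\<Sum>x<d. \<Sum>y<d. ed (ln_m (emp_init n d E C \<eta>)) e x y * ed U e x y)
        = (\<Sum>x<d. \<Sum>y<d. - \<eta> * (ed C e x y * ed U e x y) - ln (?Ze e) * ed U e x y)"
      using that Ze[of e] by (intro sum.cong) (auto simp: ln_m_def emp_init_def ln_div algebra_simps)
    also have "\<dots> = - \<eta> * (\<Sum>x<d. \<Sum>y<d. ed C e x y * ed U e x y) - ln (?Ze e) * (\<Sum>x<d. \<Sum>y<d. ed U e x y)"
      by (simp only: sum_subtractf sum_distrib_left)
    finally show ?thesis using L2_edge_sum[OF U that] by simp
  qed
  ultimately show ?thesis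
    unfolding inner_m_def log_partition_def
    by (simp add: sum_subtractf sum_negf distrib_left flip: sum_distrib_left)
qed

text \<open>The right-hand side is the second argument of the minimum in \<open>S0\<close>.\<close>

lemma potential_emp_init:
  "potential (emp_init n d E C \<eta>) =
     (\<Sum>e\<in>E. ln (\<Sum>x<d. \<Sum>y<d. exp (- \<eta> * ed C e x y)) + (\<Sum>x<d. \<Sum>y<d. \<eta> / (real d)^2 * ed C e x y))
      + (\<Sum>i<n. ln (\<Sum>x<d. exp (- \<eta> * vx C i x)) + (\<Sum>x<d. \<eta> / real d * vx C i x))"
proof -
  have "(\<Sum>i<n. \<Sum>x<d. vx C i x * vx uniform_m i x) = (\<Sum>i<n. \<Sum>x<d. vx C i x / real d)"
    by (intro sum.cong) (auto simp: uniform_m_def)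
  moreover have "(\<Sum>e\<in>E. \<Sum>x<d. \<Sum>y<d. ed C e x y * ed uniform_m e x y) = (\<Sum>e\<in>E. \<Sum>x<d. \<Sum>y<d. ed C e x y / (real d)\<^sup>2)"
    by (intro sum.cong) (auto simp: uniform_m_def)
  ultimately show ?thesis
    unfolding potential_def inner_ln_emp_init[OF uniform_m_in_L2]
    by (simp add: log_partition_def inner_m_def sum.distrib distrib_left sum_distrib_left sum_negf)
qed

text \<open>The 1-norm in \<open>S0\<close> divides edge costs by \<open>d\<close>, the potential by
  d^2. With m the mean cost, the claim is ln Z + m \<le> d m + Z. As m may be negative, it is
  bounded below by 2 ln d - ln Z, which leaves an inequality in Z and d.\<close>

lemma log_sum_exp_le_grid:
  fixes u :: "nat \<Rightarrow> nat \<Rightarrow> real"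
  shows "ln (\<Sum>x<d. \<Sum>y<d. exp (- u x y)) + (\<Sum>x<d. \<Sum>y<d. u x y) / (real d)\<^sup>2
     \<le> (\<Sum>x<d. \<Sum>y<d. u x y / real d + exp (- u x y))"
proof -
  define Z where "Z = (\<Sum>x<d. \<Sum>y<d. exp (- u x y))"
  define m where "m = (\<Sum>x<d. \<Sum>y<d. u x y) / (real d)\<^sup>2"
  have Z: "0 < Z" unfolding Z_def
    using d_pos by (intro sum_pos) (auto simp: lessThan_empty_iff)
  have d: "1 \<le> real d" using d_pos by simp
  have "2 * ln (real d) \<le> ln Z + m"
    using log_sum_exp_mean_ge[of "{..<d} \<times> {..<d}" "\<lambda>(x, y). u x y"] d_pos
    by (auto simp: Z_def m_def sum.cartesian_product case_prod_beta lessThan_empty_iff ln_mult power2_eq_square)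
  then have "(real d - 1) * (2 * ln (real d)) \<le> (real d - 1) * (ln Z + m)"
    using d by (intro mult_left_mono) auto
  \<comment> \<open>The tangent to ln at d; after that only 0 \<le> d + (d - 2) ln d is
    missing.\<close>
  moreover have "ln (Z / real d) \<le> Z / real d - 1" using Z d by (intro ln_le_minus_one) simp
  then have "real d * (ln Z - ln (real d)) \<le> real d * (Z / real d - 1)"
    using Z d by (intro mult_left_mono) (auto simp: ln_div)
  then have "real d * (ln Z - ln (real d)) \<le> Z - real d" using d by (simp add: right_diff_distrib)
  moreover have "0 \<le> real d + (real d - 2) * ln (real d)"
  proof (cases "d = 1")
    case False
    then have "2 \<le> real d" using d_pos by simp
    then show ?thesis using d by simp
  qed simp
  ultimately have "ln Z + m \<le> real d * m + Z" by (simp add: algebra_simps)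
  moreover have "real d * m = (\<Sum>x<d. \<Sum>y<d. u x y) / real d"
    using d by (simp add: m_def power2_eq_square)
  ultimately show ?thesis
    by (simp add: sum.distrib Z_def m_def sum_divide_distrib)
qed

lemma potential_emp_init_le_S0: "potential (emp_init n d E C \<eta>) \<le> S0 n d E C \<eta>"
proof -
  let ?M = "\<lparr> vx = (\<lambda>i x. \<eta> * vx C i x / d + exp (- \<eta> * vx C i x)),
                       ed = (\<lambda>e x y. \<eta> * ed C e x y / d + exp (- \<eta> * ed C e x y)) \<rparr>"
  have "ln (\<Sum>x<d. \<Sum>y<d. exp (- \<eta> * ed C e x y)) + (\<Sum>x<d. \<Sum>y<d. \<eta> / (real d)^2 * ed C e x y)
      \<le> (\<Sum>x<d. \<Sum>y<d. \<bar>ed ?M e x y\<bar>)" for e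
  proof -
    have "ln (\<Sum>x<d. \<Sum>y<d. exp (- \<eta> * ed C e x y)) + (\<Sum>x<d. \<Sum>y<d. \<eta> / (real d)^2 * ed C e x y)
        \<le> (\<Sum>x<d. \<Sum>y<d. ed ?M e x y)"
      using log_sum_exp_le_grid[of "\<lambda>x y. \<eta> * ed C e x y"] by (simp add: sum_divide_distrib)
    also have "\<dots> \<le> (\<Sum>x<d. \<Sum>y<d. \<bar>ed ?M e x y\<bar>)" by (intro sum_mono) auto
    finally show ?thesis .
  qed
  moreover have "ln (\<Sum>x<d. exp (- \<eta> * vx C i x)) + (\<Sum>x<d. \<eta> / real d * vx C i x)
      \<le> (\<Sum>x<d. \<bar>vx ?M i x\<bar>)" for i
  proof -
    have "0 < (\<Sum>x<d. exp (- \<eta> * vx C i x))"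
      using d_pos by (intro sum_pos) (auto simp: lessThan_empty_iff)
    then have "ln (\<Sum>x<d. exp (- \<eta> * vx C i x)) \<le> (\<Sum>x<d. exp (- \<eta> * vx C i x)) - 1"
      by (rule ln_le_minus_one)
    then have "ln (\<Sum>x<d. exp (- \<eta> * vx C i x)) + (\<Sum>x<d. \<eta> / real d * vx C i x)
        \<le> (\<Sum>x<d. vx ?M i x)" by (simp add: sum.distrib)
    also have "\<dots> \<le> (\<Sum>x<d. \<bar>vx ?M i x\<bar>)" by (intro sum_mono) auto
    finally show ?thesis .
  qed
  ultimately have "potential (emp_init n d E C \<eta>) \<le> norm1_m n d E ?M"
    unfolding potential_emp_init norm1_m_def by (simp only: add.commute) (intro add_mono sum_mono; simp)
  then show ?thesis unfolding S0_def by (simp add: potential_emp_init)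
qed

lemma abs_le_norm_inf_m:
  "i < n \<Longrightarrow> x < d \<Longrightarrow> \<bar>vx C i x\<bar> \<le> norm_inf_m n d E C"
  "e \<in> E \<Longrightarrow> x < d \<Longrightarrow> y < d \<Longrightarrow> \<bar>ed C e x y\<bar> \<le> norm_inf_m n d E C"
proof -
  let ?A = "{\<bar>vx C i x\<bar> | i x. i < n \<and> x < d} \<union> {\<bar>ed C e x y\<bar> | e x y. e \<in> E \<and> x < d \<and> y < d}"
  have "?A \<subseteq> (\<lambda>c. \<bar>coord C c\<bar>) ` Idx"
  proof
    fix a assume "a \<in> ?A"
    then consider i x where "a = \<bar>vx C i x\<bar>" "i < n" "x < d"
      | e x y where "a = \<bar>ed C e x y\<bar>" "e \<in> E" "x < d" "y < d" by blast
    then show "a \<in> (\<lambda>c. \<bar>coord C c\<bar>) ` Idx"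
    proof cases
      case 1
      then show ?thesis by (intro image_eqI[of _ _ "Inl (i, x)"]) (simp_all add: mem_Idx)
    next
      case 2
      then show ?thesis by (intro image_eqI[of _ _ "Inr (e, x, y)"]) (simp_all add: mem_Idx)
    qed
  qed
  then have "finite ?A" using finite_Idx finite_surj by blast
  then show "i < n \<Longrightarrow> x < d \<Longrightarrow> \<bar>vx C i x\<bar> \<le> norm_inf_m n d E C"
    "e \<in> E \<Longrightarrow> x < d \<Longrightarrow> y < d \<Longrightarrow> \<bar>ed C e x y\<bar> \<le> norm_inf_m n d E C"
    unfolding norm_inf_m_def by (intro Max_ge; blast)+
qed

text \<open>A bound in terms of \<open>\<eta> * norm_inf_m n d E C\<close>, the quantity against
  which the tolerance \<epsilon> is chosen.\<close>

lemma potential_emp_init_le: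
  assumes "0 \<le> \<eta>"
  shows "potential (emp_init n d E C \<eta>) \<le>
    real (card E) * (2 * ln (real d) + 2 * (\<eta> * norm_inf_m n d E C)) +
    real n * (ln (real d) + 2 * (\<eta> * norm_inf_m n d E C))"
proof -
  have d: "0 < real d" using d_pos by simp
  have "ln (\<Sum>x<d. \<Sum>y<d. exp (- \<eta> * ed C e x y)) + (\<Sum>x<d. \<Sum>y<d. \<eta> / (real d)^2 * ed C e x y)
      \<le> 2 * ln (real d) + 2 * (\<eta> * norm_inf_m n d E C)" if "e \<in> E" for e
  proof -
    have "ln (\<Sum>c\<in>{..<d} \<times> {..<d}. exp (- (\<eta> * ed C e (fst c) (snd c))))
        + (\<Sum>c\<in>{..<d} \<times> {..<d}. \<eta> * ed C e (fst c) (snd c)) / card ({..<d} \<times> {..<d})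
      \<le> ln (card ({..<d} \<times> {..<d})) + 2 * (\<eta> * norm_inf_m n d E C)"
      using d_pos abs_le_norm_inf_m(2)[OF that] assms
      by (intro log_sum_exp_plus_mean_le) (auto simp: lessThan_empty_iff abs_mult intro!: mult_left_mono)
    then show ?thesis using d
      by (simp add: sum.cartesian_product case_prod_beta ln_mult power2_eq_square sum_divide_distrib)
  qed
  moreover have "ln (\<Sum>x<d. exp (- \<eta> * vx C i x)) + (\<Sum>x<d. \<eta> / real d * vx C i x)
      \<le> ln (real d) + 2 * (\<eta> * norm_inf_m n d E C)" if "i < n" for i
  proof -
    have "ln (\<Sum>x<d. exp (- (\<eta> * vx C i x))) + (\<Sum>x<d. \<eta> * vx C i x) / card {..<d}
      \<le> ln (card {..<d}) + 2 * (\<eta> * norm_inf_m n d E C)"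
      using d_pos abs_le_norm_inf_m(1)[OF that] assms
      by (intro log_sum_exp_plus_mean_le) (auto simp: lessThan_empty_iff abs_mult intro!: mult_left_mono)
    then show ?thesis by (simp add: sum_divide_distrib)
  qed
  ultimately have "potential (emp_init n d E C \<eta>)
      \<le> (\<Sum>e\<in>E. 2 * ln (real d) + 2 * (\<eta> * norm_inf_m n d E C)) +
        (\<Sum>i<n. ln (real d) + 2 * (\<eta> * norm_inf_m n d E C))"
    unfolding potential_emp_init by (intro add_mono[OF sum_mono sum_mono]) auto
  then show ?thesis by simp
qed

subsection \<open>Rounding\<close>

text \<open>Correcting the marginals of an edge matrix additively can make entries negative, by at most
  \<open>2 \<epsilon> / d\<close>; mixing with the uniform point restores feasibility.\<close>

lemma L2_near_stopped:
  assumes G: "normalized_m G" and stop: "emp_stopped d E \<epsilon> G" and eps: "0 < \<epsilon>" "2 * real d * \<epsilon> \<le> 1"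
  obtains T where "T \<in> L2 n d E"
    "\<And>c. c \<in> Idx \<Longrightarrow> coord T c \<le> coord G c + 4 * real d * \<epsilon> * coord uniform_m c"
proof -
  \<comment> \<open>With this mixing weight the uniform point adds 2 \<epsilon> / d to every edge
    entry, just enough to offset the most negative one.\<close>
  define t where "t = 2 * real d * \<epsilon>"
  \<comment> \<open>The defect of each marginal, spread evenly along its row or column. Both
    marginals have mass one, so the defects sum to zero and the row correction leaves column sums
    unchanged, and conversely.\<close>
  define D where "D = (\<lambda>s e a. (vx G (endpt s e) a - emarg s e G a) / real d)"
  define T where "T = \<lparr> vx = (\<lambda>i x. if i < n \<and> x < d then (1 - t) * vx G i x + t / real d else 0),
    ed = (\<lambda>e x y. if e \<in> E \<and> x < d \<and> y < d
       then (1 - t) * (ed G e x y + (D True e x + D False e y)) + t / (real d)\<^sup>2 else 0) \<rparr>"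
  have d: "1 \<le> real d" using d_pos by simp
  have t: "0 \<le> t" "t \<le> 1" using eps d by (auto simp: t_def)
  have td: "t / (real d)\<^sup>2 = 2 * (\<epsilon> / real d)" using d by (simp add: t_def power2_eq_square)
  have D: "\<bar>D s e a\<bar> \<le> \<epsilon> / real d" if "e \<in> E" "a < d" for s e a
  proof -
    have "\<bar>vx G (endpt s e) a - emarg s e G a\<bar> \<le> viol (s, e) G"
      unfolding viol_def using that(2)
      by (simp, intro member_le_sum[of a _ "\<lambda>a. \<bar>vx G (endpt s e) a - emarg s e G a\<bar>"]) auto
    also have "\<dots> \<le> \<epsilon>" using stop that(1) by (auto simp: emp_stopped_viol less_imp_le)
    finally show ?thesis using d by (simp add: D_def abs_divide divide_right_mono)
  qed
  have Dsum: "(\<Sum>a<d. D s e a) = 0" if "e \<in> E" for s e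
    using vertex_sum[OF G that] emarg_sum[OF G that]
    by (simp add: D_def sum_subtractf flip: sum_divide_distrib)
  \<comment> \<open>The factor 4 consists of 2 \<epsilon> / d from the correction and 2 \<epsilon> /
    d from the mixing.\<close>
  have ed: "0 \<le> ed T e x y \<and> ed T e x y \<le> ed G e x y + 4 * real d * \<epsilon> * ed uniform_m e x y"
    if "e \<in> E" "x < d" "y < d" for e x y
  proof -
    have g: "0 \<le> ed G e x y" using normalized_coord(1)[OF G, of "Inr (e, x, y)"] that by (simp add: mem_Idx less_imp_le)
    have b: "\<bar>D True e x + D False e y\<bar> \<le> 2 * (\<epsilon> / real d)"
      using D[OF that(1,2), of True] D[OF that(1,3), of False] by linarith
    have "(1 - t) * (ed G e x y + (D True e x + D False e y)) \<ge> (1 - t) * - (2 * (\<epsilon> / real d))"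
      using g b t by (intro mult_left_mono) auto
    moreover have "(1 - t) * - (2 * (\<epsilon> / real d)) \<ge> - (2 * (\<epsilon> / real d))"
    proof -
      have "0 \<le> t * (2 * (\<epsilon> / real d))" using t eps by simp
      then show ?thesis unfolding left_diff_distrib by simp
    qed
    moreover have "(1 - t) * (ed G e x y + (D True e x + D False e y)) \<le> (1 - t) * (ed G e x y + 2 * (\<epsilon> / real d))"
      using b t by (intro mult_left_mono) auto
    moreover have "(1 - t) * (ed G e x y + 2 * (\<epsilon> / real d)) \<le> ed G e x y + 2 * (\<epsilon> / real d)"
      using t g eps d by (intro mult_left_le_one_le) auto
    moreover have "4 * real d * \<epsilon> * ed uniform_m e x y = 4 * (\<epsilon> / real d)"
      using that d by (simp add: uniform_m_def power2_eq_square)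
    moreover have "ed T e x y = (1 - t) * (ed G e x y + (D True e x + D False e y)) + 2 * (\<epsilon> / real d)"
      using that td by (simp add: T_def)
    ultimately show ?thesis by linarith
  qed
  have vx: "0 \<le> vx T i x \<and> vx T i x \<le> vx G i x + 4 * real d * \<epsilon> * vx uniform_m i x"
    if "i < n" "x < d" for i x
  proof -
    have g: "0 \<le> vx G i x" using normalized_coord(1)[OF G, of "Inl (i, x)"] that by (simp add: mem_Idx less_imp_le)
    have "(1 - t) * vx G i x \<le> vx G i x" "0 \<le> (1 - t) * vx G i x"
      using t g by (auto intro!: mult_left_le_one_le)
    moreover have "4 * real d * \<epsilon> * vx uniform_m i x = 4 * \<epsilon>" "t / real d = 2 * \<epsilon>"
      using that d by (auto simp: uniform_m_def t_def)
    moreover have "vx T i x = (1 - t) * vx G i x + t / real d" using that by (simp add: T_def)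
    ultimately show ?thesis using eps by linarith
  qed
  show ?thesis
  proof
    show "coord T c \<le> coord G c + 4 * real d * \<epsilon> * coord uniform_m c" if "c \<in> Idx" for c
      using vx ed that by (cases c) (auto simp: Idx_def)
    show "T \<in> L2 n d E"
    proof (rule L2I)
      show "0 \<le> coord T c" if "c \<in> Idx" for c
        using vx ed that by (cases c) (auto simp: Idx_def)
      show "coord T c = 0" if "c \<notin> Idx" for c
        using that by (cases c) (auto simp: Idx_def T_def split: if_splits)
      show "(\<Sum>x<d. vx T i x) = 1" if "i < n" for i
        using that G d by (simp add: T_def sum.distrib normalized_m_def flip: sum_distrib_left)
      show "(\<Sum>y<d. ed T e x y) = vx T (fst e) x" if "e \<in> E" "x < d" for e x
      proof -
        have "(\<Sum>y<d. ed T e x y) = (1 - t) * ((\<Sum>y<d. ed G e x y) + real d * D True e x + (\<Sum>y<d. D False e y)) + t / real d"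
          using that d by (simp add: T_def sum.distrib power2_eq_square add.assoc flip: sum_distrib_left)
        moreover have "(\<Sum>y<d. ed G e x y) + real d * D True e x = vx G (fst e) x"
          using d by (simp add: D_def endpt_def emarg_def edm_def)
        ultimately show ?thesis using that edges[OF that(1)] Dsum by (simp add: T_def)
      qed
      show "(\<Sum>x<d. ed T e x y) = vx T (snd e) y" if "e \<in> E" "y < d" for e y
      proof -
        have "(\<Sum>x<d. ed T e x y) = (1 - t) * ((\<Sum>x<d. ed G e x y) + ((\<Sum>x<d. D True e x) + real d * D False e y)) + t / real d"
          using that d by (simp add: T_def sum.distrib power2_eq_square flip: sum_distrib_left)
        moreover have "(\<Sum>x<d. ed G e x y) + real d * D False e y = vx G (snd e) y"
          using d by (simp add: D_def endpt_def emarg_def edm_def)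
        ultimately show ?thesis using that edges[OF that(1)] Dsum by (simp add: T_def)
      qed
    qed
  qed
qed

text \<open>Since - ln of an entry of \<open>G\<close> is nonnegative, a coordinatewise upper bound
  on \<open>T\<close> suffices. Each coordinate contributes at most 1 through - p ln p, and the
  slack contributes \<open>k\<close> times the potential.\<close>

lemma cross_entropy_le:
  assumes G: "normalized_m G" and T: "T \<in> L2 n d E"
    and le: "\<And>c. c \<in> Idx \<Longrightarrow> coord T c \<le> coord G c + k * coord uniform_m c"
  shows "- inner_m n d E (ln_m G) T \<le> real (n * d + card E * d\<^sup>2) + k * potential G"
proof -
  have card: "card Idx = n * d + card E * d\<^sup>2"
    unfolding Idx_def using finite_E by (simp add: card_Plus card_cartesian_product power2_eq_square)
  have "- inner_m n d E (ln_m G) T = (\<Sum>c\<in>Idx. - ln (coord G c) * coord T c)"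
    by (simp add: inner_m_Idx coord_ln_m sum_negf)
  also have "\<dots> \<le> (\<Sum>c\<in>Idx. 1 + k * (- ln (coord G c) * coord uniform_m c))"
  proof (rule sum_mono)
    fix c assume c: "c \<in> Idx"
    have "- ln (coord G c) * coord T c \<le> - ln (coord G c) * (coord G c + k * coord uniform_m c)"
      using normalized_coord[OF G c] le[OF c] by (intro mult_left_mono) auto
    also have "\<dots> = - (ln (coord G c) * coord G c) + k * (- ln (coord G c) * coord uniform_m c)"
      by (simp add: algebra_simps)
    finally show "- ln (coord G c) * coord T c \<le> 1 + k * (- ln (coord G c) * coord uniform_m c)"
      using neg_mult_ln_le_one[OF normalized_coord(1)[OF G c]] by linarith
  qed
  also have "\<dots> = real (n * d + card E * d\<^sup>2) + k * potential G"
    by (simp only: sum.distrib flip: sum_distrib_left) (simp add: card potential_def inner_m_Idx coord_ln_m sum_negf)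
  finally show ?thesis .
qed

lemma card_vertices_le:
  assumes "\<And>i. i < n \<Longrightarrow> \<exists>e\<in>E. fst e = i \<or> snd e = i"
  shows "n \<le> 2 * card E"
proof -
  have "{..<n} \<subseteq> fst ` E \<union> snd ` E" using assms by (force simp: image_iff)
  then have "card {..<n} \<le> card (fst ` E \<union> snd ` E)" using finite_E by (intro card_mono) auto
  also have "\<dots> \<le> card (fst ` E) + card (snd ` E)" by (rule card_Un_le)
  also have "\<dots> \<le> card E + card E" using finite_E by (intro add_mono card_image_le)
  finally show ?thesis by simp
qed

lemma stopped_majority:
  assumes opt: "opt_vertices n d E C = {V}" and V: "V = indicator_m y" "\<And>i. i < n \<Longrightarrow> y i < d"
    and cover: "\<And>i. i < n \<Longrightarrow> \<exists>e\<in>E. fst e = i \<or> snd e = i" and n: "1 \<le> n"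
    and eta: "\<eta> \<ge> (2 * ln (16 * real n ^ 2 * real d ^ 2) + 16 * real (card E) * real d ^ 2)
                   / real_of_ereal (min (Delta n d E C) (ereal (1/128)))"
    and eps_pos: "\<epsilon> > 0"
    and eps: "1 / \<epsilon> > (25 * real d * real (deg n E) * real (card E)) ^ 2
                        * max (\<eta> * norm_inf_m n d E C) 68"
    and G: "lifts g (emp_init n d E C \<eta>) G" "0 \<le> g" and stop: "emp_stopped d E \<epsilon> G"
    and i: "i < n"
  shows "1 / 2 < vx G i (y i)"
proof -
  define \<delta> where "\<delta> = real_of_ereal (min (Delta n d E C) (ereal (1/128)))"
  define m where "m = real (card E)"
  define D where "D = real d"
  define M where "M = max (\<eta> * norm_inf_m n d E C) 68"
  have \<delta>: "0 < \<delta>" unfolding \<delta>_def by (rule unique_optimum_gap(1)[OF opt])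
  have D: "1 \<le> D" using d_pos by (simp add: D_def)
  obtain e where e: "e \<in> E" "fst e = i \<or> snd e = i" using cover[OF i] by blast
  then have "1 \<le> card E" using finite_E by (simp add: Suc_le_eq card_gt_0_iff) blast
  then have m: "1 \<le> m" by (simp add: m_def)
  have "1 \<le> card {e \<in> E. fst e = i \<or> snd e = i}"
    using finite_E e by (cases e) (auto simp: Suc_le_eq card_gt_0_iff)
  then have deg: "1 \<le> real (deg n E)" using degree_le_deg[OF i] by simp
  have n2: "real n \<le> 2 * m" using card_vertices_le[OF cover] by (simp add: m_def flip: of_nat_mult)
  have M: "68 \<le> M" "\<eta> * norm_inf_m n d E C \<le> M" by (auto simp: M_def)
  have mD: "1 \<le> m * D\<^sup>2" using m D by (simp add: mult_ge1_I)

  \<comment> \<open>The logarithm is nonnegative, so \<eta> \<delta> is at least 16 |E| d^2, four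
    times the cross-entropy bound derived below.\<close>
  have "1 \<le> 16 * (real n)\<^sup>2 * D\<^sup>2" using n D
    by (intro mult_ge1_I) (auto intro: order_trans[of 1 "16 * 1"])
  then have "0 \<le> ln (16 * (real n)\<^sup>2 * D\<^sup>2)" by simp
  then have "16 * m * D\<^sup>2 \<le> 2 * ln (16 * real n ^ 2 * real d ^ 2) + 16 * real (card E) * real d ^ 2"
    by (simp add: m_def D_def)
  also have "\<dots> \<le> \<eta> * \<delta>" using eta \<delta> by (simp add: pos_divide_le_eq flip: \<delta>_def)
  finally have eta\<delta>: "16 * (m * D\<^sup>2) \<le> \<eta> * \<delta>" by simp
  then have "0 < \<eta> * \<delta>" using mD by linarith
  then have \<eta>: "0 < \<eta>" using \<delta> by (simp add: zero_less_mult_iff)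

  have "(25 * D * 1 * m)\<^sup>2 * M \<le> (25 * D * real (deg n E) * m)\<^sup>2 * M"
    using D m M deg by (intro mult_right_mono power_mono mult_mono) auto
  also have "\<dots> \<le> 1 / \<epsilon>" using eps by (simp add: D_def m_def M_def)
  finally have "(25 * D * m)\<^sup>2 * M * \<epsilon> \<le> 1" using eps_pos by (simp add: pos_le_divide_eq)
  then have eps1: "625 * (D\<^sup>2 * m * m * M * \<epsilon>) \<le> 1" by (simp add: power_mult_distrib power2_eq_square mult_ac)
  \<comment> \<open>From 25 * 25 * 68 = 42500, which exceeds 40000.\<close>
  have "D * 68 * \<epsilon> \<le> D\<^sup>2 * m * m * M * \<epsilon>"
  proof -
    have "D * 1 * 1 * 68 \<le> D\<^sup>2 * m * m * M"
      using D m M by (intro mult_mono) (auto simp: power2_eq_square)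
    then show ?thesis using eps_pos by (intro mult_right_mono) auto
  qed
  with eps1 have eps2: "D * \<epsilon> \<le> 1 / 40000" by simp
  have "\<epsilon> \<le> D * \<epsilon>" using D eps_pos by simp
  then have eps3: "\<epsilon> \<le> 1 / 40000" using eps2 by (rule order_trans)

  have nG: "normalized_m G" using G(1) by (simp add: lifts_def)
  obtain T where T: "T \<in> L2 n d E"
    "\<And>c. c \<in> Idx \<Longrightarrow> coord T c \<le> coord G c + 4 * real d * \<epsilon> * coord uniform_m c"
    by (rule L2_near_stopped[OF nG stop eps_pos]) (use eps2 in \<open>auto simp: D_def\<close>)
  obtain l where l: "l \<le> 1" "\<And>c. l * coord V c \<le> coord T c"
    "inner_m n d E C V + \<delta> * (1 - l) \<le> inner_m n d E C T"
    using unique_optimum_gap(2)[OF opt T(1)] by (auto simp: \<delta>_def)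

  \<comment> \<open>Iterating never raises the potential. The constant 10 is 4 from the edges plus 2
    * 3 from the vertices, by n \<le> 2 |E|.\<close>
  have "potential G \<le> potential (emp_init n d E C \<eta>)" using potential_lifts[OF G(1)] G(2) by simp
  also have "\<dots> \<le> m * (2 * ln D + 2 * (\<eta> * norm_inf_m n d E C)) + real n * (ln D + 2 * (\<eta> * norm_inf_m n d E C))"
    unfolding m_def D_def using \<eta> by (intro potential_emp_init_le) simp
  also have "\<dots> \<le> m * (2 * (D * M) + 2 * (D * M)) + (2 * m) * (D * M + 2 * (D * M))"
  proof -
    have "1 * 1 \<le> D * M" "D * 1 \<le> D * M" "1 * M \<le> D * M" using D M by (intro mult_mono; simp)+
    moreover have "ln D \<le> D - 1" using D by (intro ln_le_minus_one) simp
    ultimately have a: "ln D \<le> D * M" "\<eta> * norm_inf_m n d E C \<le> D * M" using M by linarith+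
    have "real n * (ln D + 2 * (\<eta> * norm_inf_m n d E C)) \<le> real n * (D * M + 2 * (D * M))"
      using a by (intro mult_left_mono) auto
    also have "\<dots> \<le> (2 * m) * (D * M + 2 * (D * M))"
      using n2 D M by (intro mult_right_mono) auto
    finally have "real n * (ln D + 2 * (\<eta> * norm_inf_m n d E C)) \<le> (2 * m) * (D * M + 2 * (D * M))" .
    moreover have "m * (2 * ln D + 2 * (\<eta> * norm_inf_m n d E C)) \<le> m * (2 * (D * M) + 2 * (D * M))"
      using a m by (intro mult_left_mono) auto
    ultimately show ?thesis by linarith
  qed
  finally have pot: "potential G \<le> 10 * (m * D * M)" by (simp add: mult_ac)
  have "4 * D * \<epsilon> * potential G \<le> 4 * D * \<epsilon> * (10 * (m * D * M))"
    using pot D eps_pos by (intro mult_left_mono) auto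
  also have "\<dots> = 40 * (D\<^sup>2 * m * 1 * M * \<epsilon>)" by (simp add: power2_eq_square)
  also have "\<dots> \<le> 40 * (D\<^sup>2 * m * m * M * \<epsilon>)"
    using m D M eps_pos by (intro mult_left_mono mult_right_mono) auto
  also have "\<dots> \<le> m * D\<^sup>2" using eps1 mD by linarith
  finally have pot2: "4 * D * \<epsilon> * potential G \<le> m * D\<^sup>2" .

  have V_L2: "V \<in> L2 n d E" using V indicator_m_in_L2 by simp
  \<comment> \<open>The log-partition term and the gain \<open>g\<close> are the same for all
    feasible \<open>U\<close>, so they cancel between \<open>T\<close> and \<open>V\<close>.\<close>
  have ident: "inner_m n d E (ln_m G) U = - \<eta> * inner_m n d E C U - log_partition C \<eta> + g" if "U \<in> L2 n d E" for U
    using G(1) that by (simp add: lifts_def inner_ln_emp_init)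
  have "\<eta> * (\<delta> * (1 - l)) \<le> \<eta> * (inner_m n d E C T - inner_m n d E C V)"
    using l(3) \<eta> by (intro mult_left_mono) auto
  also have "\<dots> = inner_m n d E (ln_m G) V - inner_m n d E (ln_m G) T"
    using ident[OF V_L2] ident[OF T(1)] by (simp add: algebra_simps)
  also have "\<dots> \<le> - inner_m n d E (ln_m G) T" using inner_ln_nonpos[OF nG V_L2] by simp
  also have "\<dots> \<le> real (n * d + card E * d\<^sup>2) + 4 * real d * \<epsilon> * potential G"
    by (rule cross_entropy_le[OF nG T])
  \<comment> \<open>In units of |E| d^2: 2 for the vertices, 1 for the edges and 1 for the
    slack.\<close>
  also have "\<dots> \<le> 4 * (m * D\<^sup>2)"
  proof -
    have "real n * D \<le> (2 * m) * D\<^sup>2"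
      using n2 D m by (intro mult_mono) (auto simp: power2_eq_square)
    then show ?thesis using pot2 by (simp add: m_def D_def)
  qed
  finally have "\<eta> * \<delta> * (1 - l) \<le> 4 * (m * D\<^sup>2)" by simp
  moreover have "16 * (m * D\<^sup>2) * (1 - l) \<le> \<eta> * \<delta> * (1 - l)"
    using eta\<delta> l(1) by (intro mult_right_mono) auto
  ultimately have "16 * (m * D\<^sup>2) * (1 - l) \<le> 4 * (m * D\<^sup>2)" by linarith
  then have "(m * D\<^sup>2) * (4 * (1 - l)) \<le> (m * D\<^sup>2) * 1" by (simp add: algebra_simps)
  then have "4 * (1 - l) \<le> 1" using mD by (subst (asm) mult_le_cancel_left_pos) auto
  moreover have "l \<le> vx T i (y i)" using l(2)[of "Inl (i, y i)"] V i by (simp add: indicator_m_def)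
  moreover have "vx T i (y i) \<le> vx G i (y i) + 4 * \<epsilon>"
    using T(2)[of "Inl (i, y i)"] V(2)[OF i] i D by (simp add: mem_Idx uniform_m_def D_def)
  \<comment> \<open>The majority is at least 3/4 - 4 \<epsilon>, with \<epsilon> at most
    1/40000.\<close>
  ultimately show ?thesis using eps3 by argo
qed

text \<open>Two distinct states cannot both have mass above 1/2, so no tie-breaking rule can affect
  the result.\<close>

lemma majority_rounding:
  assumes G: "normalized_m G" and y: "\<And>i. i < n \<Longrightarrow> y i < d" "\<And>i. i < n \<Longrightarrow> 1 / 2 < vx G i (y i)"
    and x: "rounding_of n d G x" and i: "i < n"
  shows "x i = y i"
proof (rule ccontr)
  assume ne: "x i \<noteq> y i"
  have "x i < d" "vx G i (y i) \<le> vx G i (x i)" using x i y(1) by (auto simp: rounding_of_def)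
  moreover have "(\<Sum>a\<in>{x i, y i}. vx G i a) \<le> (\<Sum>a<d. vx G i a)"
    using G i y(1) \<open>x i < d\<close> by (intro sum_mono2) (auto simp: normalized_m_def less_imp_le)
  ultimately show False using ne G i y(2)[OF i] by (simp add: normalized_m_def)
qed

end

section \<open>Iteration counts and optimality of the rounding\<close>

theorem theorem3:
  fixes n d :: nat and es :: "(nat \<times> nat) list" and C :: marg and \<eta> \<epsilon> :: real
  defines "E \<equiv> set es"
  assumes graph: "graph_ok n es" and n_pos: "n \<ge> 1" and d_pos: "d \<ge> 1"
    and eta: "\<eta> \<ge> (2 * ln (16 * real n ^ 2 * real d ^ 2) + 16 * real (card E) * real d ^ 2)
                   / real_of_ereal (min (Delta n d E C) (ereal (1/128)))"
    and eps_pos: "\<epsilon> > 0"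
    and eps: "1 / \<epsilon> > (25 * real d * real (deg n E) * real (card E)) ^ 2
                        * max (\<eta> * norm_inf_m n d E C) 68"
    and tight: "L2_tight n d E C"
    and unique: "card (opt_vertices n d E C) = 1"
  shows "returns_MAP_within n d E C \<epsilon>
           (\<lambda>k. (emp_cyclic_iter d es ^^ k) (emp_init n d E C \<eta>)) 
           (nat \<lceil>4 * S0 n d E C \<eta> * (real (deg n E) + 1) / \<epsilon> ^ 2\<rceil>)
       \<and> (\<forall>Gs. Gs 0 = emp_init n d E C \<eta> \<longrightarrow>
              (\<forall>k. \<not> emp_stopped d E \<epsilon> (Gs k) \<longrightarrow> emp_greedy_step d E (Gs k) (Gs (Suc k))) \<longrightarrow>
              returns_MAP_within n d E C \<epsilon> Gs (nat \<lceil>4 * S0 n d E C \<eta> / \<epsilon> ^ 2\<rceil>))"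
proof -
  interpret local_polytope n d E
    using graph d_pos by unfold_locales (auto simp: E_def graph_ok_def)
  have dist: "distinct es" using graph by (simp add: graph_ok_def)
  have cover: "\<exists>e\<in>E. fst e = i \<or> snd e = i" if "i < n" for i
  proof -
    have "\<exists>(a, b)\<in>E. a = i \<or> b = i" using graph that by (simp add: graph_ok_def E_def)
    then show ?thesis by (simp add: case_prod_beta)
  qed
  obtain V where V: "opt_vertices n d E C = {V}" using unique by (auto simp: card_1_singleton_iff)
  obtain W where W: "lp_optimal n d E C W" "integral_m W" using tight by (auto simp: L2_tight_def)
  then have W_L2: "W \<in> L2 n d E" by (simp add: lp_optimal_def)
  \<comment> \<open>Integral feasible points are extreme, so uniqueness identifies the integral
    optimum with \<open>V\<close>.\<close>
  then have "W \<in> opt_vertices n d E C"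
    using W integral_is_vertex by (simp add: opt_vertices_def)
  with V have "W = V" by simp
  obtain y where y: "\<And>i. i < n \<Longrightarrow> y i < d" "V = indicator_m y"
    using integral_L2_eq_indicator[OF W_L2 W(2)] \<open>W = V\<close> by metis
  have map: "is_MAP n d E C y"
    unfolding is_MAP_def
  proof (intro conjI allI impI)
    fix z assume z: "\<forall>i<n. z i < d"
    \<comment> \<open>Each assignment is feasible for the relaxation, with its energy as objective
      value.\<close>
    then have "inner_m n d E C V \<le> inner_m n d E C (indicator_m z)"
      using W(1) \<open>W = V\<close> indicator_m_in_L2[of z] by (simp add: lp_optimal_def)
    then show "energy n E C y \<le> energy n E C z"
      using y z by (simp add: inner_indicator_m)
  qed (use y in auto)
  have round: "is_MAP n d E C x"
    if "lifts g (emp_init n d E C \<eta>) G" "0 \<le> g" "emp_stopped d E \<epsilon> G" "rounding_of n d G x" for g G x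
  proof -
    have "1 / 2 < vx G i (y i)" if "i < n" for i
      using stopped_majority[OF V y(2,1) cover n_pos eta eps_pos eps] \<open>lifts _ _ _\<close> \<open>0 \<le> g\<close>
        \<open>emp_stopped _ _ _ _\<close> that by blast
    then have eq: "x i = y i" if "i < n" for i
      using majority_rounding[of G y x i] y(1) that \<open>lifts _ _ _\<close> \<open>rounding_of _ _ _ _\<close>
      by (simp add: lifts_def)
    then have "energy n E C x = energy n E C y"
      using edges unfolding energy_def by (intro arg_cong2[where f = "(+)"] sum.cong) force+
    with map eq show ?thesis by (simp add: is_MAP_def)
  qed
  have finish: "returns_MAP_within n d E C \<epsilon> Gs (nat \<lceil>S0 n d E C \<eta> / c\<rceil>)"
    if "Gs 0 = emp_init n d E C \<eta>" "0 < c"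
      "\<And>k. normalized_m (Gs k) \<Longrightarrow> \<not> emp_stopped d E \<epsilon> (Gs k) \<Longrightarrow> \<exists>g\<ge>c. lifts g (Gs k) (Gs (Suc k))" for Gs c
  proof -
    have "\<exists>k\<le>nat \<lceil>S0 n d E C \<eta> / c\<rceil>. emp_stopped d E \<epsilon> (Gs k) \<and> (\<forall>k'<k. \<not> emp_stopped d E \<epsilon> (Gs k')) \<and>
        (\<exists>g\<ge>0. lifts g (Gs 0) (Gs k))"
      using that normalized_emp_init potential_emp_init_le_S0 by (intro first_stop) auto
    then show ?thesis unfolding returns_MAP_within_def using round that(1) by metis
  qed
  \<comment> \<open>Here one iteration is a whole sweep, with gain at least \<epsilon>^2 / (4 (deg +
    1)); in the greedy case it is a single half-step, with gain at least \<epsilon>^2 / 4.\<close>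
  have "returns_MAP_within n d E C \<epsilon> (\<lambda>k. (emp_cyclic_iter d es ^^ k) (emp_init n d E C \<eta>))
      (nat \<lceil>S0 n d E C \<eta> / (\<epsilon>\<^sup>2 / (4 * (real (deg n E) + 1)))\<rceil>)"
  proof (rule finish)
    show "0 < \<epsilon>\<^sup>2 / (4 * (real (deg n E) + 1))" using eps_pos by simp
  qed (use cyclic_iter_lifts[OF _ _ eps_pos _ dist] E_def in auto)
  moreover have "returns_MAP_within n d E C \<epsilon> Gs (nat \<lceil>S0 n d E C \<eta> / (\<epsilon>\<^sup>2 / 4)\<rceil>)"
    if "Gs 0 = emp_init n d E C \<eta>"
      "\<forall>k. \<not> emp_stopped d E \<epsilon> (Gs k) \<longrightarrow> emp_greedy_step d E (Gs k) (Gs (Suc k))" for Gs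
    using that eps_pos by (intro finish greedy_step_lifts) auto
  moreover have "S0 n d E C \<eta> / (\<epsilon>\<^sup>2 / (4 * (real (deg n E) + 1)))
      = 4 * S0 n d E C \<eta> * (real (deg n E) + 1) / \<epsilon> ^ 2" by simp
  moreover have "S0 n d E C \<eta> / (\<epsilon>\<^sup>2 / 4) = 4 * S0 n d E C \<eta> / \<epsilon> ^ 2" by simp
  ultimately show ?thesis by metis
qed

end
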